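(* Let $R$ be a $\mathbb{Q}$-domain, $n=2$, and $D$ a triangular derivation of $R[x_1,x_2]$ over $R$ with $D(x_1)=a$ and $D(x_2)=\sum_{i=0}^l b_ix_1^i$, where $l\ge0$, $a,b_0,\dots,b_l\in R$, $a\ne0$, $b_l\neq0$. Let $I=\{i\in\{0,\dots,l\}: b_i\notin aR\}$ and $f\in\ker D\setminus R$. Then $\exp fD\in\mathrm{T}(R,\mathbf{x})$ if and only if (1) $I=\emptyset$, or (2) $I=\{0\}$, and $b_0/a\in V(R)$ or $\deg_{x_2}f=1$. In particular, if $V(R)=K^\times$, then $\exp fD\in\mathrm{T}(R,\mathbf{x})$ if and only if $b_i\in aR$ for $i=1,\dots,l$.
   Context: $K$ is the field of fractions of $R$; $V(R)$ is the set of $\alpha/\beta\in K^\times$ with $\alpha,\beta\in R\setminus\{0\}$, $\alpha R+\beta R=R$. $\exp D(f)=\sum_{l\ge0}D^l(f)/l!$. $\mathrm{T}(R,\mathbf{x})$ is the subgroup of $\mathrm{Aut}(R[\mathbf{x}]/R)$ generated by affine automorphisms ($\deg\phi(x_i)=1$) and elementary automorphisms (fixing all variables but one). *)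

theory Defs
  imports "HOL-Computational_Algebra.Polynomial" "HOL-Computational_Algebra.Fraction_Field"
begin

text \<open>R[x1,x2] is represented as 'a poly poly: the outer variable is x2,
  the coefficients live in R[x1].\<close>

definition X1 :: "'a::idom poly poly" where "X1 = [:[:0, 1:]:]"
definition X2 :: "'a::idom poly poly" where "X2 = [:0, 1:]"

definition const2 :: "'a::idom \<Rightarrow> 'a poly poly" where "const2 r = [:[:r:]:]"

definition eval2 :: "'a::idom poly poly \<Rightarrow> 'a poly poly \<Rightarrow> 'a poly poly \<Rightarrow> 'a poly poly" where
  "eval2 p u v = poly (map_poly (\<lambda>c. poly (map_poly const2 c) u) p) v"

text \<open>Total degree (degree of 0 taken to be 0).\<close>
definition totdeg :: "'a::idom poly poly \<Rightarrow> nat" where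
  "totdeg p = Max (insert 0 {degree (coeff p i) + i | i. coeff p i \<noteq> 0})"

definition Aut2 :: "('a::idom poly poly \<Rightarrow> 'a poly poly) set" where
  "Aut2 = {F. bij F \<and> (\<forall>p. F p = eval2 p (F X1) (F X2))}"

definition affine_aut :: "('a::idom poly poly \<Rightarrow> 'a poly poly) \<Rightarrow> bool" where
  "affine_aut F \<longleftrightarrow> F \<in> Aut2 \<and> totdeg (F X1) = 1 \<and> totdeg (F X2) = 1"

definition elementary_aut :: "('a::idom poly poly \<Rightarrow> 'a poly poly) \<Rightarrow> bool" where
  "elementary_aut F \<longleftrightarrow> F \<in> Aut2 \<and> (F X1 = X1 \<or> F X2 = X2)"

inductive_set tame2 :: "('a::idom poly poly \<Rightarrow> 'a poly poly) set" where
  gen: "affine_aut F \<or> elementary_aut F \<Longrightarrow> F \<in> tame2"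
| comp: "F \<in> tame2 \<Longrightarrow> G \<in> tame2 \<Longrightarrow> F \<circ> G \<in> tame2"
| inverse: "F \<in> tame2 \<Longrightarrow> inv F \<in> tame2"

definition der2 :: "'a::idom poly poly \<Rightarrow> 'a poly poly \<Rightarrow> 'a poly poly \<Rightarrow> 'a poly poly" where
  "der2 d1 d2 p = map_poly pderiv p * d1 + pderiv p * d2"

definition ratinv :: "nat \<Rightarrow> 'a::idom" where
  "ratinv n = (THE c. c * of_nat n = 1)"

text \<open>exp E (g) = sum_l E^l(g)/l!, for E locally nilpotent (finitely many nonzero terms).\<close>
definition exp_der :: "('a::idom poly poly \<Rightarrow> 'a poly poly) \<Rightarrow> 'a poly poly \<Rightarrow> 'a poly poly" where
  "exp_der E g = (\<Sum>k | (E ^^ k) g \<noteq> 0. const2 (ratinv (fact k)) * (E ^^ k) g)"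

definition Vset :: "'a::idom fract set" where
  "Vset = {Fract \<alpha> \<beta> | \<alpha> \<beta>. \<alpha> \<noteq> 0 \<and> \<beta> \<noteq> 0 \<and> (\<exists>s t. s * \<alpha> + t * \<beta> = 1)}"

end

theory Submission
  imports Defs
begin

text \<open>Let D(x1) = a, let B be an antiderivative of D(x2) and g = a x2 - B(x1). A kernel element f
  satisfies c f = h(g) with c \<noteq> 0 in R, and F = exp fD is given by F(x1) = x1 + a f and
  a F(x2) = a x2 + B(F(x1)) - B(x1).

  A tame automorphism that is not affine is an invertible R-linear combination of H1 and H2 + p(H1),
  where deg H2 \<le> deg H1 and p has coefficients in R and degree at least 2. If deg B \<ge> 2, then
  deg F(x1) < deg F(x2), so this polynomial p must agree with B / a (after a linear change of variable)
  in all degrees above 1; hence a divides b_i for i \<ge> 1. Conjugating by an elementary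
  automorphism then removes these terms and leaves x1 + a f, x2 + b_0 f. If deg f \<ge> 2, the leading
  forms of these two components are proportional, and tameness means that the ratio b_0 / a comes from
  a column of an invertible matrix, i.e. from a unimodular pair. Conversely such a pair yields a
  linear coordinate system in which F is elementary.\<close>

section \<open>Homomorphisms of polynomial rings\<close>

definition rhom :: "('a::comm_ring_1 \<Rightarrow> 'b::comm_ring_1) \<Rightarrow> bool" where
  "rhom i \<longleftrightarrow> i 1 = 1 \<and> (\<forall>x y. i (x + y) = i x + i y) \<and> (\<forall>x y. i (x * y) = i x * i y)"

lemma rhomI:
  "i 1 = 1 \<Longrightarrow> (\<And>x y. i (x + y) = i x + i y) \<Longrightarrow> (\<And>x y. i (x * y) = i x * i y) \<Longrightarrow> rhom i"
  by (simp add: rhom_def)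

lemma
  assumes "rhom i"
  shows rhom_1: "i 1 = 1" and rhom_add: "i (x + y) = i x + i y"
    and rhom_mult: "i (x * y) = i x * i y" and rhom_0: "i 0 = 0"
    and rhom_uminus: "i (- x) = - i x" and rhom_diff: "i (x - y) = i x - i y"
proof -
  show 1: "i 1 = 1" and add: "\<And>x y. i (x + y) = i x + i y" and "i (x * y) = i x * i y"
    using assms by (auto simp: rhom_def)
  show 0: "i 0 = 0" using add[of 0 0] by simp
  show um: "\<And>x. i (- x) = - i x" by (metis 0 add add.right_inverse minus_unique add.commute)
  show "i (x - y) = i x - i y" using add[of x "- y"] um[of y] by simp
qed

lemmas rhom_simps = rhom_1 rhom_add rhom_mult rhom_0 rhom_uminus rhom_diff

lemma rhom_comp: "rhom i \<Longrightarrow> rhom j \<Longrightarrow> rhom (\<lambda>x. j (i x))"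
  by (simp add: rhom_def)

lemma rhom_const: "rhom (\<lambda>c. [:c:])"
  by (rule rhomI) (auto simp: one_pCons)

lemma rhom_poly: "rhom (\<lambda>p. poly p u)"
  by (rule rhomI) auto

text \<open>The coefficient map \<open>i\<close> is kept general because the target is sometimes
  R[x1,x2] and sometimes R[x1,x2][t], where the flow of the derivation lives.\<close>

definition ev1 :: "('a::comm_ring_1 \<Rightarrow> 'b::comm_ring_1) \<Rightarrow> 'b \<Rightarrow> 'a poly \<Rightarrow> 'b" where
  "ev1 i u p = poly (map_poly i p) u"

definition ev2 :: "('a::comm_ring_1 \<Rightarrow> 'b::comm_ring_1) \<Rightarrow> 'b \<Rightarrow> 'b \<Rightarrow> 'a poly poly \<Rightarrow> 'b" where
  "ev2 i u v = ev1 (ev1 i u) v"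

lemma ev1_pCons: "rhom i \<Longrightarrow> ev1 i u (pCons c p) = i c + u * ev1 i u p"
  by (simp add: ev1_def map_poly_pCons rhom_0)

lemma ev1_0 [simp]: "ev1 i u 0 = 0" by (simp add: ev1_def)

lemma ev1_const: "rhom i \<Longrightarrow> ev1 i u [:c:] = i c"
  by (simp add: ev1_pCons)

lemma ev1_X: "rhom i \<Longrightarrow> ev1 i u [:0, 1:] = u"
  by (simp add: ev1_pCons rhom_simps)

lemma ev1_add: "rhom i \<Longrightarrow> ev1 i u (p + q) = ev1 i u p + ev1 i u q"
  by (induction p q rule: poly_induct2) (auto simp: ev1_pCons rhom_simps algebra_simps)

lemma ev1_smult: "rhom i \<Longrightarrow> ev1 i u (smult c p) = i c * ev1 i u p"
  by (induction p) (auto simp: ev1_pCons rhom_simps algebra_simps)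

lemma rhom_ev1:
  assumes "rhom i"
  shows "rhom (ev1 i u)"
proof (rule rhomI)
  show "ev1 i u 1 = 1" using assms by (simp add: one_pCons ev1_pCons rhom_simps)
  fix p q
  show "ev1 i u (p + q) = ev1 i u p + ev1 i u q" using assms by (rule ev1_add)
  show "ev1 i u (p * q) = ev1 i u p * ev1 i u q"
    by (induction p)
      (auto simp: ev1_pCons[OF assms] ev1_smult[OF assms] ev1_add[OF assms] rhom_0[OF assms] algebra_simps)
qed

lemma rhom_ev2: "rhom i \<Longrightarrow> rhom (ev2 i u v)"
  by (simp add: ev2_def rhom_ev1)

lemma const2_eq_0_iff [simp]: "const2 c = 0 \<longleftrightarrow> c = 0"
  by (simp add: const2_def)

lemma rhom_const2: "rhom const2"
  by (rule rhomI) (auto simp: const2_def one_pCons)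

lemma eval2_ev2: "eval2 p u v = ev2 const2 u v p"
  by (simp add: eval2_def ev2_def ev1_def [abs_def])

lemma rhom_eval2: "rhom (\<lambda>p. eval2 p u v)"
  using rhom_ev2[OF rhom_const2, of u v] by (simp add: eval2_ev2)

lemma ev2_const2: "rhom i \<Longrightarrow> ev2 i u v (const2 c) = i c"
  by (simp add: ev2_def const2_def ev1_const rhom_ev1)

lemma ev2_X1: "rhom i \<Longrightarrow> ev2 i u v X1 = u"
  by (simp add: ev2_def X1_def ev1_const ev1_X rhom_ev1)

lemma ev2_X2: "rhom i \<Longrightarrow> ev2 i u v X2 = v"
  by (simp add: ev2_def X2_def ev1_X rhom_ev1)

lemmas eval2_gen = ev2_const2[OF rhom_const2, folded eval2_ev2] ev2_X1[OF rhom_const2, folded eval2_ev2]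
  ev2_X2[OF rhom_const2, folded eval2_ev2]

text \<open>Constants and the two variables generate R[x1,x2] as a ring: Horner induction, first in
  the inner and then in the outer variable.\<close>

lemma poly2_induct [case_names const X1 X2 add mult]:
  fixes P :: "'a::idom poly poly \<Rightarrow> bool"
  assumes c: "\<And>r. P (const2 r)" and X1: "P X1" and X2: "P X2"
    and add: "\<And>p q. P p \<Longrightarrow> P q \<Longrightarrow> P (p + q)" and mult: "\<And>p q. P p \<Longrightarrow> P q \<Longrightarrow> P (p * q)"
  shows "P p"
proof -
  have 1: "P [:q:]" for q
  proof (induction q)
    case 0
    show ?case using c[of 0] by (simp add: const2_def)
  next
    case (pCons r q)
    have "[:pCons r q:] = const2 r + X1 * [:q:]" by (simp add: const2_def X1_def)
    then show ?case using c X1 pCons add mult by metis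
  qed
  show ?thesis
  proof (induction p)
    case 0
    show ?case using 1[of 0] by simp
  next
    case (pCons q p)
    have "pCons q p = [:q:] + X2 * p" by (simp add: X2_def)
    then show ?case using 1 X2 pCons add mult by metis
  qed
qed

lemma rhom_eqI:
  fixes F G :: "'a::idom poly poly \<Rightarrow> 'b::comm_ring_1"
  assumes "rhom F" "rhom G" "\<And>r. F (const2 r) = G (const2 r)" "F X1 = G X1" "F X2 = G X2"
  shows "F p = G p"
  by (induction p rule: poly2_induct) (simp_all add: assms rhom_simps[OF assms(1)] rhom_simps[OF assms(2)])

lemma rhom_ev1_commute:
  assumes "rhom i" "rhom H"
  shows "H (ev1 i u p) = ev1 (\<lambda>c. H (i c)) (H u) p"
  by (induction p) (simp_all add: ev1_pCons assms rhom_comp rhom_simps[OF assms(2)])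

text \<open>Factor theorem by Horner recursion. It later permits the division by \<open>a\<close> in
  the second component of the exponential.\<close>

lemma ev1_diff_dvd:
  assumes "rhom i"
  shows "u - v dvd ev1 i u p - ev1 i v p"
proof (induction p)
  case (pCons c p)
  have "ev1 i u (pCons c p) - ev1 i v (pCons c p)
      = (u - v) * ev1 i u p + v * (ev1 i u p - ev1 i v p)"
    by (simp add: ev1_pCons[OF assms] algebra_simps)
  then show ?case using pCons by (metis dvd_add dvd_mult dvd_triv_left)
qed simp

section \<open>R-algebra endomorphisms and automorphisms\<close>

text \<open>Equivalent to the substitution formula in \<open>Aut2\<close> (see
  \<open>end2_iff\<close>), but easier to handle under composition and inversion.\<close>

definition end2 :: "('a::idom poly poly \<Rightarrow> 'a poly poly) \<Rightarrow> bool" where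
  "end2 F \<longleftrightarrow> rhom F \<and> (\<forall>r. F (const2 r) = const2 r)"

lemma end2_rhom: "end2 F \<Longrightarrow> rhom F" and end2_const2: "end2 F \<Longrightarrow> F (const2 r) = const2 r"
  by (auto simp: end2_def)

lemmas end2_simps = end2_const2 rhom_simps[OF end2_rhom]

lemma end2_eqI:
  assumes "end2 F" "end2 G" "F X1 = G X1" "F X2 = G X2"
  shows "F = G"
  by (rule ext, rule rhom_eqI) (use assms in \<open>auto simp: end2_def\<close>)

lemma end2_eval2: "end2 (\<lambda>p. eval2 p u v)"
  by (simp add: end2_def rhom_eval2 eval2_gen)

lemma end2_ev1: "end2 F \<Longrightarrow> F (ev1 const2 u q) = ev1 const2 (F u) q"
  by (subst rhom_ev1_commute) (auto simp: rhom_const2 end2_def)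

lemma end2_iff: "end2 F \<longleftrightarrow> (\<forall>p. F p = eval2 p (F X1) (F X2))"
proof
  assume F: "end2 F"
  show "\<forall>p. F p = eval2 p (F X1) (F X2)"
    using end2_eqI[OF F end2_eval2[of "F X1" "F X2"]] by (metis (lifting) eval2_gen(2) eval2_gen(3))
next
  assume "\<forall>p. F p = eval2 p (F X1) (F X2)"
  then have "F = (\<lambda>p. eval2 p (F X1) (F X2))" by blast
  then show "end2 F" using end2_eval2 by metis
qed

lemma Aut2_iff: "F \<in> Aut2 \<longleftrightarrow> bij F \<and> end2 F"
  by (simp add: Aut2_def end2_iff)

lemma end2_comp: "end2 F \<Longrightarrow> end2 G \<Longrightarrow> end2 (F \<circ> G)"
  by (simp add: end2_def rhom_def)

lemma end2_id: "end2 id"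
  by (simp add: end2_def rhom_def)

lemma end2_inv:
  assumes "bij F" "end2 F"
  shows "end2 (inv F)"
proof -
  have s: "F (inv F y) = y" "inv F (F y) = y" for y
    using assms(1) by (auto simp: bij_def surj_f_inv_f)
  show ?thesis unfolding end2_def
  proof (intro conjI allI rhomI)
    show "inv F 1 = 1" using s(2)[of 1] by (simp add: end2_simps[OF assms(2)])
    show "inv F (const2 r) = const2 r" for r using s(2)[of "const2 r"] by (simp add: end2_simps[OF assms(2)])
    fix x y
    show "inv F (x + y) = inv F x + inv F y"
      using s(2)[of "inv F x + inv F y"] by (simp add: end2_simps[OF assms(2)] s(1))
    show "inv F (x * y) = inv F x * inv F y"
      using s(2)[of "inv F x * inv F y"] by (simp add: end2_simps[OF assms(2)] s(1))
  qed
qed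

lemma Aut2_inv: "F \<in> Aut2 \<Longrightarrow> inv F \<in> Aut2"
  by (simp add: Aut2_iff end2_inv bij_imp_bij_inv)

lemma Aut2_comp: "F \<in> Aut2 \<Longrightarrow> G \<in> Aut2 \<Longrightarrow> F \<circ> G \<in> Aut2"
  by (simp add: Aut2_iff end2_comp bij_comp)

text \<open>Endomorphisms are determined by the images of the variables, so the two composites need
  checking on these only.\<close>

lemma Aut2I:
  assumes F: "end2 F" and G: "end2 G"
    and FG: "F (G X1) = X1" "F (G X2) = X2" and GF: "G (F X1) = X1" "G (F X2) = X2"
  shows "F \<in> Aut2"
proof -
  have "F \<circ> G = id" "G \<circ> F = id"
    by (rule end2_eqI[OF end2_comp[OF F G] end2_id]; simp add: FG)
       (rule end2_eqI[OF end2_comp[OF G F] end2_id]; simp add: GF)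
  then show ?thesis using F by (auto simp: Aut2_iff intro: o_bij)
qed

lemma tame2_Aut2: "F \<in> tame2 \<Longrightarrow> F \<in> Aut2"
  by (induction rule: tame2.induct)
    (auto simp del: o_apply simp: Aut2_comp Aut2_inv affine_aut_def elementary_aut_def comp_def[symmetric])

section \<open>Derivations and the Jacobian\<close>

lemma map_poly_pderiv_add: "map_poly pderiv (p + q) = map_poly pderiv p + map_poly pderiv q"
  by (rule poly_eqI) (simp add: coeff_map_poly pderiv_add)

lemma map_poly_pderiv_mult:
  "map_poly pderiv (p * q) = map_poly pderiv p * q + p * map_poly pderiv (q::'a::idom poly poly)"
proof (induction p)
  case (pCons c p)
  have s: "map_poly pderiv (smult c q) = smult (pderiv c) q + smult c (map_poly pderiv q)"
    by (rule poly_eqI) (simp add: coeff_map_poly pderiv_mult algebra_simps)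
  show ?case using pCons
    by (simp add: map_poly_pCons map_poly_pderiv_add s algebra_simps)
qed simp

lemma der2_add: "der2 d1 d2 (p + q) = der2 d1 d2 p + der2 d1 d2 q"
  by (simp add: der2_def map_poly_pderiv_add pderiv_add algebra_simps)

lemma der2_mult: "der2 d1 d2 (p * q) = der2 d1 d2 p * q + p * der2 d1 d2 q"
  by (simp add: der2_def map_poly_pderiv_mult pderiv_mult algebra_simps)

lemma der2_gen [simp]: "der2 d1 d2 (const2 r) = 0" "der2 d1 d2 X1 = d1" "der2 d1 d2 X2 = d2"
  by (simp_all add: der2_def const2_def X1_def X2_def map_poly_pCons pderiv_pCons)
    (simp flip: one_pCons)

text \<open>The chain rule, \<open>der2 1 0\<close> and \<open>der2 0 1\<close> being the partial
  derivatives.\<close>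

lemma der2_chain:
  "der2 d1 d2 (eval2 p u v)
    = eval2 (der2 1 0 p) u v * der2 d1 d2 u + eval2 (der2 0 1 p) u v * der2 d1 d2 v"
  by (induction p rule: poly2_induct)
    (simp_all add: eval2_gen der2_add der2_mult rhom_simps[OF rhom_eval2] algebra_simps)

lemma der2_ev1: "der2 d1 d2 (ev1 const2 u q) = ev1 const2 u (pderiv q) * der2 d1 d2 u"
proof (induction q)
  case 0
  then show ?case using der2_gen(1)[of d1 d2 0] by (simp add: const2_def)
next
  case (pCons c q)
  then show ?case
    by (simp add: ev1_pCons rhom_const2 der2_add der2_mult pderiv_pCons ev1_add algebra_simps rhom_simps[OF rhom_const2])
qed

definition jacobian :: "('a::idom poly poly \<Rightarrow> 'a poly poly) \<Rightarrow> 'a poly poly" where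
  "jacobian F = der2 1 0 (F X1) * der2 0 1 (F X2) - der2 0 1 (F X1) * der2 1 0 (F X2)"

lemma dvd_1_const2: "p dvd 1 \<Longrightarrow> \<exists>e. e dvd 1 \<and> p = const2 e"
  unfolding is_unit_poly_iff const2_def by (metis is_unit_poly_iff)

text \<open>The chain rule along the inverse makes the Jacobian matrix invertible; its determinant
  is then a unit of R[x1,x2], and over a domain such units lie in R.\<close>

lemma jacobian_unit:
  assumes "F \<in> Aut2"
  shows "\<exists>e. e dvd 1 \<and> jacobian F = const2 e"
proof -
  define P Q where "P = inv F X1" and "Q = inv F X2"
  have "bij F" and F: "\<forall>p. F p = eval2 p (F X1) (F X2)"
    using assms unfolding Aut2_def by blast+
  from \<open>bij F\<close> have "F P = X1" "F Q = X2" unfolding P_def Q_def by (auto simp: bij_def surj_f_inv_f)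
  then have X: "eval2 P (F X1) (F X2) = X1" "eval2 Q (F X1) (F X2) = X2"
    using spec[OF F, of P] spec[OF F, of Q] by simp_all
  define p1 p2 q1 q2 where "p1 = eval2 (der2 1 0 P) (F X1) (F X2)"
    and "p2 = eval2 (der2 0 1 P) (F X1) (F X2)" and "q1 = eval2 (der2 1 0 Q) (F X1) (F X2)"
    and "q2 = eval2 (der2 0 1 Q) (F X1) (F X2)"
  \<comment> \<open>The Jacobian matrix of the inverse, evaluated along \<open>F\<close>, times that
    of \<open>F\<close> is the identity.\<close>
  have e: "p1 * der2 1 0 (F X1) + p2 * der2 1 0 (F X2) = 1"
    "p1 * der2 0 1 (F X1) + p2 * der2 0 1 (F X2) = 0"
    "q1 * der2 1 0 (F X1) + q2 * der2 1 0 (F X2) = 0"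
    "q1 * der2 0 1 (F X1) + q2 * der2 0 1 (F X2) = 1"
    unfolding p1_def p2_def q1_def q2_def by (simp_all add: der2_chain[symmetric] X)
  \<comment> \<open>Multiplicativity of the 2x2 determinant, written out.\<close>
  have "jacobian F * (p1 * q2 - p2 * q1)
      = (p1 * der2 1 0 (F X1) + p2 * der2 1 0 (F X2)) * (q1 * der2 0 1 (F X1) + q2 * der2 0 1 (F X2))
      - (p1 * der2 0 1 (F X1) + p2 * der2 0 1 (F X2)) * (q1 * der2 1 0 (F X1) + q2 * der2 1 0 (F X2))"
    unfolding jacobian_def by (simp add: algebra_simps)
  then have "jacobian F dvd 1" unfolding e by (metis diff_zero dvdI mult_1 mult_zero_left)
  then show ?thesis by (rule dvd_1_const2)
qed

section \<open>Degrees in the tame group\<close>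

definition aff :: "'a::idom poly poly \<Rightarrow> 'a poly poly \<Rightarrow> 'a poly poly \<Rightarrow> 'a poly poly \<Rightarrow> bool" where
  "aff U V U' V' \<longleftrightarrow> (\<exists>\<alpha> \<beta> \<gamma> \<delta> c d. \<alpha> * \<delta> - \<beta> * \<gamma> dvd 1
     \<and> U' = const2 \<alpha> * U + const2 \<beta> * V + const2 c \<and> V' = const2 \<gamma> * U + const2 \<delta> * V + const2 d)"

lemmas const2_simps = rhom_simps[OF rhom_const2]

lemma affI:
  "\<alpha> * \<delta> - \<beta> * \<gamma> dvd 1 \<Longrightarrow> U' = const2 \<alpha> * U + const2 \<beta> * V + const2 c
    \<Longrightarrow> V' = const2 \<gamma> * U + const2 \<delta> * V + const2 d \<Longrightarrow> aff U V U' V'"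
  unfolding aff_def by blast

lemma aff_refl: "aff U V U V"
  by (rule affI[of 1 1 0 0 _ _ _ 0 _ 0]) (simp_all add: const2_simps)

lemma aff_swap: "aff U V V U"
  by (rule affI[of 0 0 1 1 _ _ _ 0 _ 0]) (simp_all add: const2_simps)

lemma aff_trans:
  assumes "aff U V U' V'" "aff U' V' U'' V''"
  shows "aff U V U'' V''"
proof -
  obtain \<alpha> \<beta> \<gamma> \<delta> c d where 1: "\<alpha> * \<delta> - \<beta> * \<gamma> dvd 1"
    "U' = const2 \<alpha> * U + const2 \<beta> * V + const2 c" "V' = const2 \<gamma> * U + const2 \<delta> * V + const2 d"
    using assms(1) unfolding aff_def by blast
  obtain \<alpha>' \<beta>' \<gamma>' \<delta>' c' d' where 2: "\<alpha>' * \<delta>' - \<beta>' * \<gamma>' dvd 1"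
    "U'' = const2 \<alpha>' * U' + const2 \<beta>' * V' + const2 c'" "V'' = const2 \<gamma>' * U' + const2 \<delta>' * V' + const2 d'"
    using assms(2) unfolding aff_def by blast
  have "(\<alpha>' * \<alpha> + \<beta>' * \<gamma>) * (\<gamma>' * \<beta> + \<delta>' * \<delta>) - (\<alpha>' * \<beta> + \<beta>' * \<delta>) * (\<gamma>' * \<alpha> + \<delta>' * \<gamma>)
      = (\<alpha>' * \<delta>' - \<beta>' * \<gamma>') * (\<alpha> * \<delta> - \<beta> * \<gamma>)"
    by (simp add: algebra_simps)
  also have "\<dots> dvd 1" using mult_dvd_mono[OF 2(1) 1(1)] by simp
  finally show ?thesis
    by (rule affI[where c = "\<alpha>' * c + \<beta>' * d + c'" and d = "\<gamma>' * c + \<delta>' * d + d'"])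
      (simp_all add: 1 2 const2_simps algebra_simps)
qed

text \<open>A shear of degree at most 1 is affine, which is why the steps of \<open>good\<close>
  start at degree 2.\<close>

lemma aff_shear:
  assumes "degree q \<le> 1" "e dvd 1"
  shows "aff U V U (const2 e * V + ev1 const2 U q)"
proof -
  have "q = [:coeff q 0, coeff q 1:]"
    using assms(1) by (intro poly_eqI) (auto simp: coeff_pCons coeff_eq_0 split: nat.splits)
  then have "ev1 const2 U q = const2 (coeff q 0) + U * const2 (coeff q 1)"
    by (metis add_0_right ev1_0 ev1_pCons mult_zero_right rhom_const2)
  then show ?thesis
    by (intro affI[of 1 e 0 "coeff q 1" _ _ _ 0 _ "coeff q 0"])
      (simp_all add: assms const2_simps algebra_simps)
qed

lemma degree_const2_mult_le: "degree (const2 c * U) \<le> degree U"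
  by (simp add: const2_def)

lemma degree_const2_mult: "c \<noteq> 0 \<Longrightarrow> degree (const2 c * U) = degree (U :: 'a::idom poly poly)"
  by (simp add: const2_def)

lemma degree_const2 [simp]: "degree (const2 c) = 0"
  by (simp add: const2_def)

lemma ev1_pcompose: "ev1 const2 u p = pcompose (map_poly (\<lambda>c. [:c:]) p) u"
proof (induction p)
  case (pCons c p)
  then show ?case
    by (simp add: ev1_pCons rhom_const2 map_poly_pCons pcompose_pCons) (simp add: const2_def)
qed simp

lemma degree_ev1: "degree (ev1 const2 u p) = degree p * degree (u :: 'a::idom poly poly)"
  by (simp add: ev1_pcompose degree_pcompose degree_map_poly)

lemma ev1_ev1_affine:
  "ev1 const2 (const2 \<alpha> * u + const2 c) q = ev1 const2 u (pcompose q [:c, \<alpha>:])"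
  by (induction q) (simp_all add: ev1_pCons rhom_const2 pcompose_pCons
      rhom_simps[OF rhom_ev1[OF rhom_const2]] ev1_smult const2_simps algebra_simps)

lemma degree_add_const2: "degree (p + const2 c) = degree (p :: 'a::idom poly poly)"
proof (cases "degree p = 0")
  case True
  then show ?thesis by (metis add_0 degree_0_id degree_const2 degree_pCons_0 const2_def add_pCons)
next
  case False
  then show ?thesis by (intro degree_add_eq_left) simp
qed

section \<open>Pairs built by degree-raising steps\<close>

text \<open>The base pair is the substitution x1 = t, x2 = s t, with t the outer and s the inner variable:
  it turns the total degree into the degree in t, which is additive on products.\<close>

inductive good :: "'a::idom poly poly \<Rightarrow> 'a poly poly \<Rightarrow> bool" where
  base: "aff X2 (X1 * X2) U V \<Longrightarrow> good U V"
| step: "good H1 H2 \<Longrightarrow> degree H2 \<le> degree H1 \<Longrightarrow> degree p \<ge> 2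
    \<Longrightarrow> aff H1 (H2 + ev1 const2 H1 p) U V \<Longrightarrow> good U V"

lemma good_aff: "good U V \<Longrightarrow> aff U V U' V' \<Longrightarrow> good U' V'"
  by (induction rule: good.induct) (auto intro: good.intros aff_trans)

lemma degree_base:
  assumes "\<alpha> \<noteq> 0 \<or> \<beta> \<noteq> 0"
  shows "degree (const2 \<alpha> * X2 + const2 \<beta> * (X1 * X2) + const2 c) = 1"
proof -
  have "const2 \<alpha> * X2 + const2 \<beta> * (X1 * X2) + const2 c = [:[:c:], [:\<alpha>, \<beta>:]:]"
    by (simp add: const2_def X1_def X2_def)
  then show ?thesis using assms by auto
qed

lemma unit_det_row:
  assumes "\<alpha> * \<delta> - \<beta> * \<gamma> dvd (1::'a::idom)"
  shows "\<alpha> \<noteq> 0 \<or> \<beta> \<noteq> 0" "\<gamma> \<noteq> 0 \<or> \<delta> \<noteq> 0"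
  using assms by auto

lemma degree_aff_base:
  assumes "aff X2 (X1 * X2) U V"
  shows "degree U = 1" "degree V = 1"
  using assms unfolding aff_def using unit_det_row degree_base by metis+

text \<open>The composed term dominates: its degree is at least twice that of \<open>H1\<close>,
  hence above that of \<open>H2\<close>, so nothing cancels.\<close>

lemma degree_step:
  assumes "degree H2 \<le> degree H1" "degree H1 \<ge> 1" "degree p \<ge> 2"
  shows "degree (H2 + ev1 const2 H1 p) = degree p * degree H1" "degree (H2 + ev1 const2 H1 p) > degree H1"
proof -
  have "degree p * degree H1 > degree H1" using assms by simp
  then have *: "degree p * degree H1 > degree H1" "degree p * degree H1 > degree H2" using assms(1) by linarith+
  then show "degree (H2 + ev1 const2 H1 p) = degree p * degree H1"
    by (subst degree_add_eq_right) (auto simp: degree_ev1)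
  then show "degree (H2 + ev1 const2 H1 p) > degree H1" using * by simp
qed

text \<open>Distinct degrees rule out cancellation.\<close>

lemma degree_comb:
  assumes "degree H < degree G"
  shows "\<beta> \<noteq> 0 \<Longrightarrow> degree (const2 \<alpha> * H + const2 \<beta> * G + const2 c) = degree G"
    and "\<beta> = 0 \<Longrightarrow> \<alpha> \<noteq> 0 \<Longrightarrow> degree (const2 \<alpha> * H + const2 \<beta> * G + const2 c) = degree H"
  by (subst degree_add_const2, subst degree_add_eq_right)
    (use assms degree_const2_mult_le[of \<alpha> H] in \<open>auto simp: degree_const2_mult degree_add_const2 const2_simps\<close>)

lemma degree_comb_le:
  assumes "degree H < degree G"
  shows "degree (const2 \<alpha> * H + const2 \<beta> * G + const2 c) \<le> degree G"
  using assms degree_const2_mult_le[of \<alpha> H] degree_const2_mult_le[of \<beta> G]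
  by (auto simp: degree_add_const2 intro!: degree_add_le)

text \<open>Both rows of an invertible matrix are nonzero, so neither component can become
  constant.\<close>

lemma good_degree_pos: "good U V \<Longrightarrow> degree U \<ge> 1 \<and> degree V \<ge> 1"
proof (induction rule: good.induct)
  case (base U V)
  then show ?case by (simp add: degree_aff_base)
next
  case (step H1 H2 p U V)
  then have lt: "degree H1 < degree (H2 + ev1 const2 H1 p)" using degree_step by blast
  obtain \<alpha> \<beta> \<gamma> \<delta> c d where A: "\<alpha> * \<delta> - \<beta> * \<gamma> dvd 1"
    and U: "U = const2 \<alpha> * H1 + const2 \<beta> * (H2 + ev1 const2 H1 p) + const2 c"
    and V: "V = const2 \<gamma> * H1 + const2 \<delta> * (H2 + ev1 const2 H1 p) + const2 d"
    using \<open>aff _ _ U V\<close> unfolding aff_def by blast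
  have "degree (const2 x * H1 + const2 y * (H2 + ev1 const2 H1 p) + const2 z) \<ge> 1" if "x \<noteq> 0 \<or> y \<noteq> 0" for x y z
    using degree_comb[OF lt, of y x z] that step.IH lt by (cases "y = 0") auto
  then show ?case unfolding U V using unit_det_row[OF A] by blast
qed

text \<open>The decisive closure property: a shear of degree at least 2 either adds a step or merges
  with the last one, according to whether \<open>U\<close> contains the dominant term H2 +
  p(H1).\<close>

lemma good_shear:
  assumes "good U V"
  shows "good U (V + ev1 const2 U q)"
proof (cases "degree q \<le> 1")
  case True
  have "aff U V U (V + ev1 const2 U q)" using aff_shear[OF True, of 1 U V] by (simp add: const2_simps)
  then show ?thesis using assms good_aff by blast
next
  case q: False
  then have q: "degree q \<ge> 2" by simp
  from assms show ?thesis
  proof (cases rule: good.cases)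
    case base
    show ?thesis by (rule good.step[OF assms _ q aff_refl]) (simp add: degree_aff_base[OF base])
  next
    case (step H1 H2 p)
    have pos: "degree H1 \<ge> 1" using good_degree_pos step by blast
    have lt: "degree H1 < degree (H2 + ev1 const2 H1 p)" using degree_step pos step by blast
    obtain \<alpha> \<beta> \<gamma> \<delta> c d where A: "\<alpha> * \<delta> - \<beta> * \<gamma> dvd 1"
      and U: "U = const2 \<alpha> * H1 + const2 \<beta> * (H2 + ev1 const2 H1 p) + const2 c"
      and V: "V = const2 \<gamma> * H1 + const2 \<delta> * (H2 + ev1 const2 H1 p) + const2 d"
      using step(4) unfolding aff_def by blast
    show ?thesis
    proof (cases "\<beta> = 0")
      case False
      \<comment> \<open>\<open>U\<close> contains the dominant term and so has maximal degree: the
        shear is a new step on top of the pair.\<close>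
      have "degree V \<le> degree U"
        unfolding U V using degree_comb(1)[OF lt False] degree_comb_le[OF lt] by metis
      then show ?thesis by (rule good.step[OF assms _ q aff_refl])
    next
      case True
      \<comment> \<open>The determinant is now \<alpha>\<delta>, so \<open>U\<close> is affine in
        \<open>H1\<close> and q(U) is a polynomial in \<open>H1\<close>.\<close>
      then have "\<alpha> dvd 1" "\<delta> dvd 1" using A by (auto dest: dvd_mult_left dvd_mult_right)
      then obtain \<delta>' where d: "\<delta> * \<delta>' = 1" by (auto simp: dvd_def)
      \<comment> \<open>Absorbs q(U) into p; \<delta>' compensates the coefficient \<delta> of the
        dominant term in \<open>V\<close>.\<close>
      define p' where "p' = p + smult \<delta>' (pcompose q [:c, \<alpha>:])"
      have U': "U = const2 \<alpha> * H1 + const2 c" using U True by (simp add: const2_simps)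
      have dd: "const2 \<delta> * const2 \<delta>' = 1" using d by (metis const2_simps(1) const2_simps(3))
      have qU: "ev1 const2 U q = ev1 const2 H1 (pcompose q [:c, \<alpha>:])"
        unfolding U' by (rule ev1_ev1_affine)
      have "const2 \<delta> * ev1 const2 H1 p' = const2 \<delta> * ev1 const2 H1 p + (const2 \<delta> * const2 \<delta>') * ev1 const2 U q"
        unfolding p'_def qU by (simp add: rhom_simps[OF rhom_ev1[OF rhom_const2]] 
            ev1_smult rhom_const2 algebra_simps)
      then have V': "V + ev1 const2 U q = const2 \<gamma> * H1 + const2 \<delta> * (H2 + ev1 const2 H1 p') + const2 d"
        unfolding V dd by (simp add: algebra_simps)
      have *: "aff H1 (H2 + ev1 const2 H1 p') U (V + ev1 const2 U q)"
        by (rule affI[OF A _ V']) (use U' True in \<open>simp add: const2_simps\<close>)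
      show ?thesis
      \<comment> \<open>Leading terms may cancel in \<open>p'\<close>; if its degree drops to at
        most 1, the last step disappears.\<close>
      proof (cases "degree p' \<le> 1")
        case True
        have "aff H1 H2 H1 (H2 + ev1 const2 H1 p')"
          using aff_shear[OF True, of 1 H1 H2] by (simp add: const2_simps)
        then show ?thesis using good_aff[OF \<open>good H1 H2\<close>] aff_trans * by blast
      next
        case False
        then show ?thesis using good.step[OF step(1,2) _ *] by simp
      qed
    qed
  qed
qed

lemma aff_hom: "end2 G \<Longrightarrow> aff U V U' V' \<Longrightarrow> aff (G U) (G V) (G U') (G V')"
  unfolding aff_def by (force simp: end2_simps)

lemma aff_sym:
  assumes "aff U V U' V'"
  shows "aff U' V' U V"
proof -
  obtain \<alpha> \<beta> \<gamma> \<delta> c d where A: "\<alpha> * \<delta> - \<beta> * \<gamma> dvd 1"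
    "U' = const2 \<alpha> * U + const2 \<beta> * V + const2 c" "V' = const2 \<gamma> * U + const2 \<delta> * V + const2 d"
    using assms unfolding aff_def by blast
  obtain e where e: "(\<alpha> * \<delta> - \<beta> * \<gamma>) * e = 1" using A(1) by (metis dvdE)
  \<comment> \<open>\<open>E\<close> is 1 in disguise: multiplying by it turns Cramer's rule into a
    ring identity.\<close>
  define E where "E = const2 e * (const2 \<alpha> * const2 \<delta> - const2 \<beta> * const2 \<gamma>)"
  have E: "E = 1" using e unfolding E_def by (metis const2_simps(1,3,6) mult.commute)
  show ?thesis
  proof (rule affI)
    have "(e * \<delta>) * (e * \<alpha>) - (- (e * \<beta>)) * (- (e * \<gamma>)) = e * ((\<alpha> * \<delta> - \<beta> * \<gamma>) * e)"
      by (simp add: algebra_simps)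
    then show "(e * \<delta>) * (e * \<alpha>) - (- (e * \<beta>)) * (- (e * \<gamma>)) dvd 1" using e by (metis dvd_triv_right mult.right_neutral)
    have "E * U = const2 (e * \<delta>) * U' + const2 (- (e * \<beta>)) * V' + const2 (e * (\<beta> * d - \<delta> * c))"
      unfolding A E_def by (simp add: const2_simps algebra_simps)
    then show "U = const2 (e * \<delta>) * U' + const2 (- (e * \<beta>)) * V' + const2 (e * (\<beta> * d - \<delta> * c))"
      by (simp add: E)
    have "E * V = const2 (- (e * \<gamma>)) * U' + const2 (e * \<alpha>) * V' + const2 (e * (\<gamma> * c - \<alpha> * d))"
      unfolding A E_def by (simp add: const2_simps algebra_simps)
    then show "V = const2 (- (e * \<gamma>)) * U' + const2 (e * \<alpha>) * V' + const2 (e * (\<gamma> * c - \<alpha> * d))"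
      by (simp add: E)
  qed
qed

section \<open>Generators of the tame group in coordinates\<close>

lemma ev1_X1: "ev1 const2 X1 q = [:q:]"
  by (induction q) (simp_all add: ev1_pCons rhom_const2, simp add: const2_def X1_def)

lemma ev1_X2: "ev1 const2 X2 q = map_poly (\<lambda>c. [:c:]) q"
  by (simp add: ev1_pcompose X2_def pcompose_idR)

lemma finite_totdeg_set: "finite {degree (coeff p i) + i | i. coeff p i \<noteq> 0}"
proof -
  have "{degree (coeff p i) + i | i. coeff p i \<noteq> 0} \<subseteq> (\<lambda>i. degree (coeff p i) + i) ` {..degree p}"
    by (auto simp: le_degree)
  then show ?thesis by (rule finite_subset) simp
qed

lemma totdeg_eq_1D:
  assumes "totdeg p = 1"
  shows "\<exists>\<alpha> \<beta> c. p = const2 \<alpha> * X1 + const2 \<beta> * X2 + const2 c"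
proof -
  have le: "degree (coeff p i) + i \<le> 1" if "coeff p i \<noteq> 0" for i
  proof -
    have "degree (coeff p i) + i \<le> totdeg p"
      unfolding totdeg_def using that by (intro Max_ge) (auto simp: finite_totdeg_set)
    then show ?thesis using assms by simp
  qed
  have c: "coeff (coeff p i) j = 0" if "i + j > 1" for i j
    using le[of i] that by (cases "coeff p i = 0") (auto intro: coeff_eq_0)
  have "p = [:[:coeff (coeff p 0) 0, coeff (coeff p 0) 1:], [:coeff (coeff p 1) 0:]:]"
    by (intro poly_eqI) (auto simp: coeff_pCons c split: nat.splits)
  also have "\<dots> = const2 (coeff (coeff p 0) 1) * X1 + const2 (coeff (coeff p 1) 0) * X2 + const2 (coeff (coeff p 0) 0)"
    by (simp add: const2_def X1_def X2_def)
  finally show ?thesis by blast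
qed

lemma totdeg_linear:
  assumes "\<alpha> \<noteq> 0 \<or> \<beta> \<noteq> 0"
  shows "totdeg (const2 \<alpha> * X1 + const2 \<beta> * X2 + const2 c) = 1"
proof -
  have e: "const2 \<alpha> * X1 + const2 \<beta> * X2 + const2 c = [:[:c, \<alpha>:], [:\<beta>:]:]" (is "?p = _")
    by (simp add: const2_def X1_def X2_def)
  show ?thesis unfolding totdeg_def
  proof (rule Max_eqI)
    show "finite (insert 0 {degree (coeff ?p i) + i |i. coeff ?p i \<noteq> 0})"
      by (rule finite.insertI[OF finite_totdeg_set])
    have "degree (coeff ?p i) + i \<le> 1" if "coeff ?p i \<noteq> 0" for i
    proof (cases i)
      case (Suc j)
      then show ?thesis using that unfolding e by (cases j) auto
    qed (simp add: e)
    then show "y \<le> 1" if "y \<in> insert 0 {degree (coeff ?p i) + i |i. coeff ?p i \<noteq> 0}" for y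
      using that by blast
    have "\<exists>i. 1 = degree (coeff [:[:c, \<alpha>:], [:\<beta>:]:] i) + i \<and> coeff [:[:c, \<alpha>:], [:\<beta>:]:] i \<noteq> 0"
    proof (cases "\<beta> = 0")
      case True
      then show ?thesis using assms by (intro exI[of _ 0]) auto
    next
      case False
      then show ?thesis by (intro exI[of _ 1]) auto
    qed
    then show "1 \<in> insert 0 {degree (coeff ?p i) + i |i. coeff ?p i \<noteq> 0}"
      unfolding e by blast
  qed
qed

lemma totdeg_const2_mult: "c \<noteq> 0 \<Longrightarrow> totdeg (const2 c * p) = totdeg p"
  by (simp add: totdeg_def const2_def)

definition char0 :: "'a::idom itself \<Rightarrow> bool" where
  "char0 _ \<longleftrightarrow> (\<forall>n. n \<noteq> 0 \<longrightarrow> (of_nat n :: 'a) \<noteq> 0)"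

lemma char0D: "char0 TYPE('a::idom) \<Longrightarrow> n \<noteq> 0 \<Longrightarrow> (of_nat n :: 'a) \<noteq> 0"
  by (simp add: char0_def)

lemma char0_poly: "char0 TYPE('a::idom) \<Longrightarrow> char0 TYPE('a poly)"
  by (simp add: char0_def of_nat_poly)

lemma pderiv_constD:
  assumes "char0 TYPE('a::idom)" "pderiv (p :: 'a poly) = [:e:]"
  shows "p = [:coeff p 0, e:]"
proof (rule poly_eqI)
  fix n
  have c: "of_nat (Suc k) * coeff p (Suc k) = coeff [:e:] k" for k
    by (metis assms(2) coeff_pderiv)
  show "coeff p n = coeff [:coeff p 0, e:] n"
  proof (cases n)
    case (Suc k)
    show ?thesis
    proof (cases k)
      case 0
      then show ?thesis using c[of 0] Suc by simp
    next
      case (Suc j)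
      then show ?thesis
        using c[of k] char0D[OF assms(1), of "Suc k"] \<open>n = Suc k\<close> by (simp del: of_nat_Suc)
    qed
  qed simp
qed

text \<open>The Jacobian of an affine map is the determinant of its linear part, hence that
  determinant is a unit.\<close>

lemma aff_affine:
  assumes "affine_aut F"
  shows "aff X1 X2 (F X1) (F X2)"
proof -
  obtain \<alpha> \<beta> c where u: "F X1 = const2 \<alpha> * X1 + const2 \<beta> * X2 + const2 c"
    using assms totdeg_eq_1D unfolding affine_aut_def by blast
  obtain \<gamma> \<delta> d where v: "F X2 = const2 \<gamma> * X1 + const2 \<delta> * X2 + const2 d"
    using assms totdeg_eq_1D unfolding affine_aut_def by blast
  obtain e where e: "e dvd 1" "jacobian F = const2 e"
    using assms jacobian_unit unfolding affine_aut_def by blast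
  have "jacobian F = const2 (\<alpha> * \<delta> - \<beta> * \<gamma>)"
    unfolding jacobian_def u v by (simp add: der2_add der2_mult const2_simps)
  then have "\<alpha> * \<delta> - \<beta> * \<gamma> = e" using e by (simp add: const2_def)
  then show ?thesis using e u v by (auto intro: affI)
qed

text \<open>The Jacobian reduces to the x2-derivative of \<open>F X2\<close>, which is thus a unit
  constant; characteristic zero then makes \<open>F X2\<close> linear in x2.\<close>

lemma elementary_fix_X1:
  assumes "char0 TYPE('a::idom)" "(F :: 'a poly poly \<Rightarrow> 'a poly poly) \<in> Aut2" "F X1 = X1"
  shows "\<exists>e q. e dvd 1 \<and> F X2 = const2 e * X2 + ev1 const2 X1 q"
proof -
  obtain e where e: "e dvd 1" "jacobian F = const2 e" using assms jacobian_unit by blast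
  then have "pderiv (F X2) = [:[:e:]:]"
    by (simp add: jacobian_def assms(3)) (simp add: der2_def const2_def)
  then have "F X2 = [:coeff (F X2) 0, [:e:]:]" by (rule pderiv_constD[OF char0_poly[OF assms(1)]])
  also have "\<dots> = const2 e * X2 + ev1 const2 X1 (coeff (F X2) 0)"
    by (simp add: ev1_X1 const2_def X2_def)
  finally show ?thesis using e by blast
qed

text \<open>Mirror image of the previous case, argued coefficientwise because x1 sits in the
  coefficient ring.\<close>

lemma elementary_fix_X2:
  assumes "char0 TYPE('a::idom)" "(F :: 'a poly poly \<Rightarrow> 'a poly poly) \<in> Aut2" "F X2 = X2"
  shows "\<exists>e q. e dvd 1 \<and> F X1 = const2 e * X1 + ev1 const2 X2 q"
proof -
  obtain e where e: "e dvd 1" "jacobian F = const2 e" using assms jacobian_unit by blast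
  define u where "u = F X1"
  from e have p: "map_poly pderiv u = [:[:e:]:]"
    by (simp add: jacobian_def assms(3) u_def) (simp add: der2_def const2_def)
  have "pderiv (coeff u n) = coeff [:[:e:]:] n" for n
    by (metis p coeff_map_poly pderiv_0)
  then have "pderiv (coeff u n) = [:if n = 0 then e else 0:]" for n
    by (cases n) auto
  then have c: "coeff u n = [:coeff (coeff u n) 0, if n = 0 then e else 0:]" for n
    by (rule pderiv_constD[OF assms(1)])
  have "u = const2 e * X1 + ev1 const2 X2 (map_poly (\<lambda>c. coeff c 0) u)"
  proof (rule poly_eqI)
    fix n
    have "coeff (const2 e * X1 + ev1 const2 X2 (map_poly (\<lambda>c. coeff c 0) u)) n
        = (if n = 0 then [:0, e:] else 0) + [:coeff (coeff u n) 0:]"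
      by (simp add: ev1_X2 coeff_map_poly const2_def X1_def coeff_pCons split: nat.splits)
    also have "\<dots> = coeff u n" by (subst (2) c) simp
    finally show "coeff u n = coeff (const2 e * X1 + ev1 const2 X2 (map_poly (\<lambda>c. coeff c 0) u)) n" ..
  qed
  then show ?thesis using e unfolding u_def by blast
qed

section \<open>Action of the tame group on good pairs\<close>

text \<open>Quantified over all good pairs, not only the base pair, so that it is stable under
  composition.\<close>

definition preserves_good :: "('a::idom poly poly \<Rightarrow> 'a poly poly) \<Rightarrow> bool" where
  "preserves_good F \<longleftrightarrow> (\<forall>U V. good U V \<longrightarrow> good (eval2 (F X1) U V) (eval2 (F X2) U V))"

lemma preserves_good_aff:
  assumes "aff X1 X2 (F X1) (F X2)"
  shows "preserves_good F"
  using aff_hom[OF end2_eval2 assms] good_aff unfolding preserves_good_def eval2_gen by blast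

lemma good_swap: "good U V \<Longrightarrow> good V U"
  by (erule good_aff) (rule aff_swap)

lemma good_shear_unit:
  assumes "good U V" "e dvd 1"
  shows "good U (const2 e * V + ev1 const2 U q)"
proof -
  have "good U (const2 e * V)"
    using good_aff[OF assms(1) aff_shear[of 0 e, OF _ assms(2)]] by simp
  then show ?thesis by (rule good_shear)
qed

lemma preserves_good_elementary:
  assumes "char0 TYPE('a::idom)" "elementary_aut (F :: 'a poly poly \<Rightarrow> 'a poly poly)"
  shows "preserves_good F"
proof -
  have A: "F \<in> Aut2" and "F X1 = X1 \<or> F X2 = X2" using assms by (auto simp: elementary_aut_def)
  then consider "F X1 = X1" | "F X2 = X2" by blast
  then show ?thesis
  proof cases
    case 1
    obtain e q where "e dvd 1" "F X2 = const2 e * X2 + ev1 const2 X1 q"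
      using elementary_fix_X1[OF assms(1) A 1] by blast
    then show ?thesis unfolding preserves_good_def
      by (simp add: 1 eval2_gen end2_simps[OF end2_eval2] end2_ev1[OF end2_eval2] good_shear_unit)
  next
    case 2
    obtain e q where "e dvd 1" "F X1 = const2 e * X1 + ev1 const2 X2 q"
      using elementary_fix_X2[OF assms(1) A 2] by blast
    then show ?thesis unfolding preserves_good_def
      by (auto simp: 2 eval2_gen end2_simps[OF end2_eval2] end2_ev1[OF end2_eval2]
          intro: good_swap good_shear_unit)
  qed
qed

lemma Aut2_inv_apply:
  assumes "F \<in> Aut2"
  shows "F (inv F p) = p" "inv F (F p) = p"
  using assms by (auto simp: Aut2_iff bij_def surj_f_inv_f)

lemma inv_elementary: "elementary_aut F \<Longrightarrow> elementary_aut (inv F)"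
  unfolding elementary_aut_def using Aut2_inv Aut2_inv_apply by metis

lemma inv_aff:
  assumes "F \<in> Aut2" "aff X1 X2 (F X1) (F X2)"
  shows "aff X1 X2 (inv F X1) (inv F X2)"
  using aff_hom[OF _ aff_sym[OF assms(2)], of "inv F"] Aut2_inv[OF assms(1)]
  by (simp add: Aut2_inv_apply[OF assms(1)] Aut2_iff)

lemma preserves_good_comp:
  assumes "end2 F" "end2 G" "preserves_good F" "preserves_good G"
  shows "preserves_good (F \<circ> G)"
proof -
  have F: "F p = eval2 p (F X1) (F X2)" for p using assms(1) end2_iff by blast
  \<comment> \<open>The pair is transformed first by \<open>F\<close> and then by
    \<open>G\<close>.\<close>
  have e: "eval2 (F p) U V = eval2 p (eval2 (F X1) U V) (eval2 (F X2) U V)" for p U V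
  proof -
    have "(\<lambda>p. eval2 p U V) \<circ> F = (\<lambda>p. eval2 p (eval2 (F X1) U V) (eval2 (F X2) U V))"
      by (rule end2_eqI[OF end2_comp[OF end2_eval2 assms(1)] end2_eval2]) (simp_all add: eval2_gen)
    then show ?thesis by (metis comp_apply)
  qed
  show ?thesis using assms(3,4)
    unfolding preserves_good_def comp_apply e[of "G X1"] e[of "G X2"] by blast
qed

text \<open>Carrying \<open>inv F\<close> along closes the induction: the inverse rule merely swaps
  the two halves.\<close>

lemma tame2_preserves_good:
  assumes "char0 TYPE('a::idom)" "(F :: 'a poly poly \<Rightarrow> 'a poly poly) \<in> tame2"
  shows "preserves_good F \<and> preserves_good (inv F)"
  using assms(2)
proof (induction rule: tame2.induct)
  case (gen F)
  then show ?case
  proof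
    assume "affine_aut F"
    then show ?thesis using aff_affine inv_aff preserves_good_aff unfolding affine_aut_def by blast
  next
    assume "elementary_aut F"
    then show ?thesis using inv_elementary preserves_good_elementary[OF assms(1)] by blast
  qed
next
  case (comp F G)
  then have *: "F \<in> Aut2" "G \<in> Aut2" using tame2_Aut2 by auto
  then have "inv (F \<circ> G) = inv G \<circ> inv F" by (simp add: o_inv_distrib Aut2_iff)
  moreover have "end2 F" "end2 G" "end2 (inv F)" "end2 (inv G)"
    using * *[THEN Aut2_inv] by (simp_all add: Aut2_iff)
  ultimately show ?case using comp.IH preserves_good_comp by metis
next
  case (inverse F)
  then show ?case using tame2_Aut2[of F] by (simp add: Aut2_iff inv_inv_eq)
qed

lemma tame2_good:
  assumes "char0 TYPE('a::idom)" "(F :: 'a poly poly \<Rightarrow> 'a poly poly) \<in> tame2"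
  shows "good (eval2 (F X1) X2 (X1 * X2)) (eval2 (F X2) X2 (X1 * X2))"
  using tame2_preserves_good[OF assms] good.base[OF aff_refl] unfolding preserves_good_def by blast

section \<open>The kernel of a triangular derivation\<close>

lemma pderiv_surj:
  assumes "\<forall>n::nat. n \<noteq> 0 \<longrightarrow> (\<exists>c::'a::idom. c * of_nat n = 1)"
  shows "\<exists>B :: 'a poly. pderiv B = p \<and> coeff B 0 = 0"
proof -
  obtain c :: "nat \<Rightarrow> 'a" where c: "c (Suc n) * of_nat (Suc n) = 1" for n using assms by (metis nat.distinct(1))
  define B where "B = (\<Sum>i\<le>degree p. monom (c (Suc i) * coeff p i) (Suc i))"
  have c': "of_nat (Suc i) * (c (Suc i) * x) = x" for i x
    using c[of i] by (metis mult.assoc mult.commute mult_1)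
  have "pderiv B = (\<Sum>i\<le>degree p. monom (coeff p i) i)"
    unfolding B_def by (simp add: higher_pderiv_sum[of "Suc 0", simplified] pderiv_monom c' del: of_nat_Suc)
  then have "pderiv B = p" by (simp add: poly_as_sum_of_monoms)
  moreover have "coeff B 0 = 0" by (simp add: B_def coeff_sum)
  ultimately show ?thesis by blast
qed

text \<open>g = a x2 - B(x1) generates the kernel up to denominators. The leading coefficient in x2
  of a kernel element lies in R, so a multiple of a power of g cancels it, at the cost of a power of
  \<open>a\<close> collected in \<open>c\<close>.\<close>

lemma der2_kernel:
  fixes a :: "'a::idom"
  assumes ch: "char0 TYPE('a)" and a: "a \<noteq> 0" and B: "pderiv B = q"
    and f: "der2 (const2 a) [:q:] f = 0"
  shows "\<exists>c h. c \<noteq> 0 \<and> const2 c * f = ev1 const2 (const2 a * X2 - ev1 const2 X1 B) h"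
  using f
proof (induction "degree f" arbitrary: f rule: less_induct)
  case less
  define g where "g = const2 a * X2 - ev1 const2 X1 B"
  define n where "n = degree f"
  have qe: "[:q:] = ev1 const2 X1 q" by (simp add: ev1_X1)
  have g: "g = [:- B, [:a:]:]" by (simp add: g_def ev1_X1 const2_def X2_def)
  have der_diff: "der2 d1 d2 (u - v) = der2 d1 d2 u - der2 d1 d2 v" for d1 d2 u and v :: "'a poly poly"
    using der2_add[of d1 d2 "u - v" v] by simp
  have Dg: "der2 (const2 a) [:q:] g = 0"
    unfolding g_def qe by (simp add: der_diff der2_mult der2_ev1 B)
  have Dgn: "der2 (const2 a) [:q:] (g ^ k) = 0" for k
  proof (induction k)
    case 0
    show ?case using der2_gen(1)[of _ _ 1] by (simp add: const2_simps)
  qed (simp add: der2_mult Dg)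
  \<comment> \<open>In degree \<open>n\<close> the x2-derivative contributes nothing, so the leading
    coefficient has zero derivative.\<close>
  have "coeff (der2 (const2 a) [:q:] f) n = pderiv (coeff f n) * [:a:]"
    by (simp add: der2_def const2_def coeff_map_poly coeff_pderiv n_def coeff_eq_0 mult.commute)
  then have "pderiv (coeff f n) = [:0:]" using less.prems a by simp
  then have "coeff f n = [:coeff (coeff f n) 0, 0:]" by (rule pderiv_constD[OF ch])
  then obtain r where r: "coeff f n = [:r:]" by (metis pCons_0_0)
  show ?case
  proof (cases "n = 0")
    case True
    then have "f = [:coeff f 0:]" unfolding n_def by (simp add: degree_0_id)
    then have "f = const2 r" using r True by (simp add: const2_def)
    then show ?thesis
      by (intro exI[of _ 1] exI[of _ "[:r:]"]) (simp add: const2_simps ev1_const rhom_const2)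
  next
    case False
    \<comment> \<open>Both terms have the coefficient r a^n at x2^n, so the degree drops.\<close>
    define f' where "f' = const2 (a ^ n) * f - const2 r * g ^ n"
    have dg: "degree (g ^ n) = n" and lg: "coeff (g ^ n) n = [:a:] ^ n"
      using lead_coeff_power[of g n] a by (simp_all add: g degree_power_eq)
    have "coeff f' n = 0"
      by (simp add: f'_def lg r const2_def poly_const_pow)
    moreover have "degree f' \<le> n" unfolding f'_def
      using degree_const2_mult_le[of "a ^ n" f] degree_const2_mult_le[of r "g ^ n"] dg
      by (intro degree_diff_le) (auto simp: n_def)
    ultimately have "degree f' < n" using False by (metis degree_0 leading_coeff_0_iff neq0_conv nat_less_le)
    moreover have "der2 (const2 a) [:q:] f' = 0"
      unfolding f'_def by (simp add: der_diff der2_mult Dgn less.prems)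
    ultimately obtain c h where ch: "c \<noteq> 0" "const2 c * f' = ev1 const2 g h"
      using less.hyps[of f'] unfolding n_def g_def by blast
    have gn: "ev1 const2 g (monom 1 k) = g ^ k" for k
      by (induction k) (simp_all add: monom_0 monom_Suc ev1_pCons rhom_const2 const2_simps)
    have "const2 (c * a ^ n) * f = const2 c * f' + const2 (c * r) * g ^ n"
      by (simp add: f'_def const2_simps algebra_simps)
    also have "\<dots> = ev1 const2 g (h + smult (c * r) (monom 1 n))"
      by (simp add: ch ev1_add ev1_smult rhom_const2 gn)
    finally show ?thesis using ch(1) a unfolding g_def by (metis mult_eq_0_iff power_not_zero)
  qed
qed

section \<open>Tameness of the exponential\<close>

text \<open>Cancelling \<open>c\<close> transfers invariance from \<open>g\<close> to
  \<open>f\<close>.\<close>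

lemma end2_eval2_fixed:
  assumes "end2 G" "const2 c * f = ev1 const2 g h" "c \<noteq> 0" "G g = g"
  shows "G f = f"
proof -
  have "const2 c * G f = G (const2 c * f)" by (simp add: end2_simps[OF assms(1)])
  also have "\<dots> = const2 c * f" by (simp add: assms(2,4) end2_ev1[OF assms(1)])
  finally show ?thesis using assms(3) by (simp)
qed

lemma elementary_shear:
  "elementary_aut (\<lambda>p. eval2 p X1 (X2 + ev1 const2 X1 q))"
proof -
  have "(\<lambda>p. eval2 p X1 (X2 + ev1 const2 X1 q)) \<in> Aut2"
    by (rule Aut2I[OF end2_eval2 end2_eval2[of X1 "X2 - ev1 const2 X1 q"]])
      (simp_all add: eval2_gen end2_simps[OF end2_eval2] end2_ev1[OF end2_eval2])
  then show ?thesis by (simp add: elementary_aut_def eval2_gen)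
qed

section \<open>Translations along an invariant\<close>

text \<open>Linear \<open>h\<close> makes c f linear. The inverse is the translation with -f,
  because both maps fix \<open>f\<close>.\<close>

lemma translation_affine:
  fixes a :: "'a::idom"
  assumes F: "end2 F" "F X1 = X1 + const2 a * f" "F X2 = X2 + const2 b * f"
    and f: "const2 c * f = ev1 const2 (const2 a * X2 - const2 b * X1) h"
    and nz: "c \<noteq> 0" "a \<noteq> 0" "b \<noteq> 0" and h: "degree h = 1"
  shows "affine_aut F"
proof -
  define g where "g = const2 a * X2 - const2 b * X1"
  define G where "G = (\<lambda>p. eval2 p (X1 - const2 a * f) (X2 - const2 b * f))"
  have G: "end2 G" "G X1 = X1 - const2 a * f" "G X2 = X2 - const2 b * f"
    by (simp_all add: G_def end2_eval2 eval2_gen)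
  have Ff: "F f = f"
    by (rule end2_eval2_fixed[OF F(1) f nz(1)]) (simp add: F end2_simps[OF F(1)] algebra_simps)
  have Gf: "G f = f"
    by (rule end2_eval2_fixed[OF G(1) f nz(1)]) (simp add: G end2_simps[OF G(1)] algebra_simps)
  have A: "F \<in> Aut2"
    by (rule Aut2I[OF F(1) G(1)]) (simp_all add: F G end2_simps[OF F(1)] end2_simps[OF G(1)] Ff Gf)
  obtain h0 h1 where h01: "h = [:h0, h1:]" "h1 \<noteq> 0" using h degree1_coeffs by metis
  have cf: "const2 c * f = const2 h0 + const2 h1 * (const2 a * X2 - const2 b * X1)"
    unfolding f h01(1) by (simp add: ev1_pCons rhom_const2)
  have "const2 c * F X1 = const2 c * X1 + const2 a * (const2 c * f)"
    "const2 c * F X2 = const2 c * X2 + const2 b * (const2 c * f)"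
    unfolding F by (simp_all add: algebra_simps)
  then have "const2 c * F X1 = const2 (c - a * h1 * b) * X1 + const2 (a * h1 * a) * X2 + const2 (a * h0)"
    "const2 c * F X2 = const2 (- (b * h1 * b)) * X1 + const2 (c + b * h1 * a) * X2 + const2 (b * h0)"
    unfolding cf by (simp_all add: const2_simps algebra_simps)
  \<comment> \<open>Each component keeps a nonzero linear term, so its total degree is exactly
    1.\<close>
  moreover have "a * h1 * a \<noteq> 0" "- (b * h1 * b) \<noteq> 0" using nz h01 by auto
  ultimately have "totdeg (const2 c * F X1) = 1" "totdeg (const2 c * F X2) = 1"
    by (simp_all only: totdeg_linear simp_thms)
  then show ?thesis using A nz(1) by (simp add: affine_aut_def totdeg_const2_mult)
qed

text \<open>In the coordinates \<beta> x2 - \<alpha> x1 and t x1 + s x2 the first one is fixed by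
  \<open>F\<close> and \<open>f\<close> depends on it alone, so \<open>F\<close> becomes
  elementary.\<close>

lemma translation_unimodular_tame:
  fixes a :: "'a::idom"
  assumes F: "end2 F" "F X1 = X1 + const2 a * f" "F X2 = X2 + const2 b * f"
    and f: "const2 c * f = ev1 const2 (const2 a * X2 - const2 b * X1) h" and nz: "c \<noteq> 0"
    and u: "\<beta> \<noteq> 0" "s * \<alpha> + t * \<beta> = 1" "b * \<beta> = a * \<alpha>"
  shows "F \<in> tame2"
proof -
  \<comment> \<open>The common factor: the Bezout relation gives a = \<beta> e and b = \<alpha>
    e.\<close>
  define e where "e = s * b + t * a"
  have "\<beta> * e = (s * \<alpha> + t * \<beta>) * a" using u(3) unfolding e_def by (simp add: algebra_simps)
  then have ae: "a = \<beta> * e" by (simp add: u)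
  have "\<alpha> * e = (s * \<alpha> + t * \<beta>) * b" using u(3) unfolding e_def by (simp add: algebra_simps)
  then have be: "b = \<alpha> * e" by (simp add: u)
  \<comment> \<open>A linear change of determinant -1 by the Bezout relation; \<open>N\<close> is
    its inverse.\<close>
  define M where "M = (\<lambda>p. eval2 p (const2 (- \<alpha>) * X1 + const2 \<beta> * X2 + const2 0) (const2 t * X1 + const2 s * X2 + const2 0))"
  define N where "N = (\<lambda>p. eval2 p (const2 \<beta> * X2 - const2 s * X1) (const2 t * X1 + const2 \<alpha> * X2))"
  have M: "end2 M" "M X1 = const2 \<beta> * X2 - const2 \<alpha> * X1" "M X2 = const2 t * X1 + const2 s * X2"
    by (simp_all add: M_def end2_eval2 eval2_gen const2_simps)
  have N: "end2 N" "N X1 = const2 \<beta> * X2 - const2 s * X1" "N X2 = const2 t * X1 + const2 \<alpha> * X2"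
    by (simp_all add: N_def end2_eval2 eval2_gen)
  have st: "const2 s * const2 \<alpha> + const2 t * const2 \<beta> = 1" using u(2) by (metis const2_simps(1-3))
  have "(const2 s * const2 \<alpha> + const2 t * const2 \<beta>) * X1 = X1" "(const2 s * const2 \<alpha> + const2 t * const2 \<beta>) * X2 = X2"
    by (simp_all add: st)
  then have "M \<in> Aut2"
    by (intro Aut2I[OF M(1) N(1)]) (simp_all add: M N end2_simps[OF M(1)] end2_simps[OF N(1)] algebra_simps)
  moreover have "totdeg (M X1) = 1" "totdeg (M X2) = 1"
    unfolding M_def eval2_gen by (rule totdeg_linear, use u(1) in simp, rule totdeg_linear, use u(2) in auto)
  ultimately have Mt: "affine_aut M" by (simp add: affine_aut_def)
  \<comment> \<open>\<open>f\<close> in the new coordinates. Its multiple by \<open>c\<close> is a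
    polynomial in e x1, so it has degree 0 in x2.\<close>
  define f' where "f' = inv M f"
  have Mi: "M f' = f" unfolding f'_def using \<open>M \<in> Aut2\<close> by (rule Aut2_inv_apply)
  have "M (const2 c * f') = M (ev1 const2 (const2 e * X1) h)"
    by (simp add: end2_simps[OF M(1)] end2_ev1[OF M(1)] Mi f) (simp add: ae be M const2_simps algebra_simps)
  then have "const2 c * f' = ev1 const2 (const2 e * X1) h"
    using \<open>M \<in> Aut2\<close> by (simp add: Aut2_iff bij_def inj_eq)
  then have "degree (const2 c * f') = 0" by (simp add: degree_ev1) (simp add: const2_def X1_def)
  then have "degree f' = 0" by (simp add: degree_const2_mult nz)
  then have f': "f' = ev1 const2 X1 (coeff f' 0)" by (simp add: ev1_X1 degree_0_id)
  define \<epsilon> where "\<epsilon> = (\<lambda>p. eval2 p X1 (X2 + ev1 const2 X1 (smult e (coeff f' 0))))"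
  have \<epsilon>: "elementary_aut \<epsilon>" "end2 \<epsilon>" "\<epsilon> X1 = X1" "\<epsilon> X2 = X2 + const2 e * f'"
    unfolding \<epsilon>_def by (rule elementary_shear) (simp_all add: end2_eval2 eval2_gen ev1_smult rhom_const2 flip: f')
  have "F (M X1) = M X1 + const2 (b * \<beta> - a * \<alpha>) * f"
    by (simp add: F M end2_simps[OF F(1)] const2_simps algebra_simps)
  then have 1: "F (M X1) = M (\<epsilon> X1)" by (simp add: u(3) \<epsilon> const2_simps)
  have "F (M X2) = M X2 + const2 e * f"
    by (simp add: F M end2_simps[OF F(1)] e_def const2_simps algebra_simps)
  then have 2: "F (M X2) = M (\<epsilon> X2)" by (simp add: \<epsilon> end2_simps[OF M(1)] Mi)
  have "F \<circ> M = M \<circ> \<epsilon>"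
    by (rule end2_eqI[OF end2_comp[OF F(1) M(1)] end2_comp[OF M(1) \<epsilon>(2)]]) (simp_all add: 1 2)
  then have "F \<circ> M \<circ> inv M = M \<circ> \<epsilon> \<circ> inv M" by simp
  moreover have "M \<circ> inv M = id" using \<open>M \<in> Aut2\<close> by (auto simp: Aut2_inv_apply)
  ultimately have "F = M \<circ> \<epsilon> \<circ> inv M" by (metis comp_assoc comp_id)
  moreover have "M \<in> tame2" "\<epsilon> \<in> tame2" using Mt \<epsilon>(1) tame2.gen by auto
  ultimately show ?thesis by (auto intro: tame2.intros simp del: o_apply)
qed

text \<open>Both components have t-degree deg h, but the combination \<delta> U - \<beta> V has
  smaller degree. This forces \<delta> a = \<beta> b, with \<beta>, \<delta> a column of an
  invertible matrix.\<close>

lemma translation_tame_imp: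
  fixes a :: "'a::idom"
  assumes ch: "char0 TYPE('a)"
    and F: "end2 F" "F X1 = X1 + const2 a * f" "F X2 = X2 + const2 b * f"
    and f: "const2 c * f = ev1 const2 (const2 a * X2 - const2 b * X1) h"
    and nz: "c \<noteq> 0" "a \<noteq> 0" "b \<noteq> 0" and h: "degree h \<ge> 2" and tame: "F \<in> tame2"
  shows "\<exists>\<alpha> \<beta> s t. \<beta> \<noteq> 0 \<and> s * \<alpha> + t * \<beta> = 1 \<and> b * \<beta> = a * \<alpha>"
proof -
  define \<phi> where "\<phi> = eval2 f X2 (X1 * X2)"
  define U V where "U = X2 + const2 a * \<phi>" and "V = X1 * X2 + const2 b * \<phi>"
  have good: "good U V"
    using tame2_good[OF ch tame] by (simp add: F U_def V_def \<phi>_def end2_simps[OF end2_eval2] eval2_gen)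
  have "const2 c * \<phi> = eval2 (const2 c * f) X2 (X1 * X2)"
    by (simp add: \<phi>_def end2_simps[OF end2_eval2])
  also have "\<dots> = ev1 const2 (const2 a * (X1 * X2) - const2 b * X2) h"
    unfolding f by (simp add: end2_ev1[OF end2_eval2] end2_simps[OF end2_eval2] eval2_gen)
  \<comment> \<open>A nonzero form of t-degree 1, so substituting it into \<open>h\<close> gives
    t-degree deg h.\<close>
  also have "const2 a * (X1 * X2) - const2 b * X2 = [:0, [:- b, a:]:]"
    by (simp add: const2_def X1_def X2_def)
  finally have "degree (const2 c * \<phi>) = degree h" using nz by (simp add: degree_ev1)
  then have d\<phi>: "degree \<phi> = degree h" using nz by (simp add: degree_const2_mult)
  have dU: "degree U = degree h" unfolding U_def
    using h nz by (subst degree_add_eq_right) (auto simp: degree_const2_mult d\<phi>, simp_all add: X2_def)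
  have dV: "degree V = degree h" unfolding V_def
    using h nz by (subst degree_add_eq_right) (auto simp: degree_const2_mult d\<phi>, simp_all add: X1_def X2_def)
  from good show ?thesis
  proof (cases rule: good.cases)
    case base
    then show ?thesis using degree_aff_base(1)[OF base] dU h by simp
  next
    case (step H1 H2 p)
    define G where "G = H2 + ev1 const2 H1 p"
    have lt: "degree H1 < degree G" unfolding G_def using degree_step good_degree_pos step by blast
    obtain \<alpha> \<beta> \<gamma> \<delta> c' d' where A: "\<alpha> * \<delta> - \<beta> * \<gamma> dvd 1"
      and U: "U = const2 \<alpha> * H1 + const2 \<beta> * G + const2 c'"
      and V: "V = const2 \<gamma> * H1 + const2 \<delta> * G + const2 d'"
      using step(4) unfolding aff_def G_def by blast
    \<comment> \<open>Otherwise \<open>U\<close> and \<open>V\<close> would have different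
      degrees.\<close>
    have \<beta>: "\<beta> \<noteq> 0"
    proof
      assume "\<beta> = 0"
      then have "\<alpha> \<noteq> 0" "\<delta> \<noteq> 0" using A by auto
      then have "degree U = degree H1" "degree V = degree G"
        unfolding U V using degree_comb[OF lt] \<open>\<beta> = 0\<close> by blast+
      then show False using lt dU dV by simp
    qed
    then have dG: "degree G = degree h" using degree_comb(1)[OF lt] U dU by metis
    \<comment> \<open>Cramer's rule: \<open>G\<close> is eliminated and a multiple of
      \<open>H1\<close> plus a constant remains.\<close>
    have "(const2 \<delta> * X2 - const2 \<beta> * (X1 * X2)) + const2 (\<delta> * a - \<beta> * b) * \<phi> = const2 \<delta> * U - const2 \<beta> * V"
      unfolding U_def V_def by (simp add: const2_simps algebra_simps)
    also have "\<dots> = const2 (\<alpha> * \<delta> - \<beta> * \<gamma>) * H1 + const2 (\<delta> * c' - \<beta> * d')"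
      unfolding U V by (simp add: const2_simps algebra_simps)
    finally have "degree ((const2 \<delta> * X2 - const2 \<beta> * (X1 * X2)) + const2 (\<delta> * a - \<beta> * b) * \<phi>) \<le> degree H1"
      by (simp add: degree_add_const2 degree_const2_mult_le)
    then have less: "degree ((const2 \<delta> * X2 - const2 \<beta> * (X1 * X2)) + const2 (\<delta> * a - \<beta> * b) * \<phi>) < degree h"
      using lt dG by simp
    have "const2 \<delta> * X2 - const2 \<beta> * (X1 * X2) = [:0, [:\<delta>, - \<beta>:]:]"
      by (simp add: const2_def X1_def X2_def)
    then have le1: "degree (const2 \<delta> * X2 - const2 \<beta> * (X1 * X2)) \<le> 1" by simp
    \<comment> \<open>Otherwise the \<phi> term, of degree deg h, would dominate the linear
      one.\<close>
    have eq: "\<delta> * a - \<beta> * b = 0"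
    proof (rule ccontr)
      assume "\<delta> * a - \<beta> * b \<noteq> 0"
      then have "degree (const2 (\<delta> * a - \<beta> * b) * \<phi>) = degree h" by (simp add: degree_const2_mult d\<phi>)
      then show False using less le1 h by (subst (asm) degree_add_eq_right) auto
    qed
    obtain e where e: "(\<alpha> * \<delta> - \<beta> * \<gamma>) * e = 1" using A by (metis dvdE)
    \<comment> \<open>The Bezout coefficients come from the determinant: (\<alpha> e) \<delta> -
      (\<gamma> e) \<beta> = 1.\<close>
    show ?thesis
      by (rule exI[of _ \<delta>], rule exI[of _ \<beta>], rule exI[of _ "\<alpha> * e"], rule exI[of _ "- (\<gamma> * e)"])
        (use \<beta> eq e in \<open>simp add: algebra_simps\<close>)
  qed
qed

lemma translation_tame_iff:
  fixes a :: "'a::idom"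
  assumes ch: "char0 TYPE('a)"
    and F: "end2 F" "F X1 = X1 + const2 a * f" "F X2 = X2 + const2 b * f"
    and f: "const2 c * f = ev1 const2 (const2 a * X2 - const2 b * X1) h"
    and nz: "c \<noteq> 0" "a \<noteq> 0" and h: "degree h \<ge> 1"
  shows "F \<in> tame2 \<longleftrightarrow> degree h = 1 \<or> (\<exists>\<alpha> \<beta> s t. \<beta> \<noteq> 0 \<and> s * \<alpha> + t * \<beta> = 1 \<and> b * \<beta> = a * \<alpha>)"
proof (cases "b = 0")
  case True
  \<comment> \<open>The pair (0, 1) is unimodular, so both sides hold.\<close>
  then have "\<exists>\<alpha> \<beta> s t. \<beta> \<noteq> 0 \<and> s * \<alpha> + t * \<beta> = 1 \<and> b * \<beta> = a * \<alpha>"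
    by (intro exI[of _ 0] exI[of _ 1]) simp
  then show ?thesis using translation_unimodular_tame[OF F f nz(1)] by blast
next
  case False
  show ?thesis
  proof (cases "degree h = 1")
    case True
    then show ?thesis using translation_affine[OF F f nz False] tame2.gen by blast
  next
    case h1: False
    then have "degree h \<ge> 2" using h by simp
    then show ?thesis
      using translation_unimodular_tame[OF F f nz(1)] translation_tame_imp[OF ch F f nz False] h1 by blast
  qed
qed

section \<open>Divisibility and removal of the higher coefficients\<close>

text \<open>Two expressions for a V are compared: \<psi> + B(U), and \<open>a\<close> times a
  combination with dominant part \<delta> p(H1). As \<open>U\<close> is affine in \<open>H1\<close>,
  both are polynomials in \<open>U\<close> up to terms of degree at most deg U.\<close>

lemma triangular_tame_dvd:
  fixes a :: "'a::idom"
  assumes ch: "char0 TYPE('a)"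
    and F: "end2 F" "F X1 = X1 + const2 a * f"
      "const2 a * F X2 = const2 a * X2 + ev1 const2 (X1 + const2 a * f) B - ev1 const2 X1 B"
    and f: "const2 c * f = ev1 const2 (const2 a * X2 - ev1 const2 X1 B) h"
    and nz: "c \<noteq> 0" "a \<noteq> 0" and h: "degree h \<ge> 1" and B: "degree B \<ge> 2" and tame: "F \<in> tame2"
    and i: "i \<ge> 2"
  shows "a dvd coeff B i"
proof -
  define \<phi> where "\<phi> = eval2 f X2 (X1 * X2)"
  define U V where "U = X2 + const2 a * \<phi>" and "V = eval2 (F X2) X2 (X1 * X2)"
  define \<psi> where "\<psi> = const2 a * (X1 * X2) - ev1 const2 X2 B"
  have good: "good U V"
    using tame2_good[OF ch tame] by (simp add: F U_def V_def \<phi>_def end2_simps[OF end2_eval2] eval2_gen)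
  have "const2 a * V = eval2 (const2 a * F X2) X2 (X1 * X2)"
    by (simp add: V_def end2_simps[OF end2_eval2])
  also have "\<dots> = \<psi> + ev1 const2 U B"
    unfolding F \<psi>_def U_def \<phi>_def by (simp add: end2_ev1[OF end2_eval2] end2_simps[OF end2_eval2] eval2_gen)
  finally have aV: "const2 a * V = \<psi> + ev1 const2 U B" .
  have "degree (const2 a * (X1 * X2)) \<le> 1"
    by (rule order.trans[OF degree_const2_mult_le]) (simp add: X1_def X2_def)
  then have d\<psi>: "degree \<psi> = degree B" unfolding \<psi>_def
    using B by (subst diff_conv_add_uminus, subst degree_add_eq_right) (auto simp: degree_ev1 X2_def)
  have "const2 c * \<phi> = eval2 (const2 c * f) X2 (X1 * X2)"
    by (simp add: \<phi>_def end2_simps[OF end2_eval2])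
  also have "\<dots> = ev1 const2 \<psi> h"
    unfolding f \<psi>_def by (simp add: end2_ev1[OF end2_eval2] end2_simps[OF end2_eval2] eval2_gen)
  finally have "degree (const2 c * \<phi>) = degree h * degree B" by (simp add: degree_ev1 d\<psi>)
  then have d\<phi>: "degree \<phi> = degree h * degree B" using nz by (simp add: degree_const2_mult)
  define n where "n = degree h * degree B"
  have nB: "degree B \<le> n" using h by (simp add: n_def)
  have dU: "degree U = n" unfolding U_def
    using nB B nz d\<phi>
    by (subst degree_add_eq_right) (simp_all add: degree_const2_mult X2_def flip: n_def)
  have nn: "degree B * n > n" "degree B * n > degree B" using B nB by auto
  have "degree (const2 a * V) = degree B * n"
    unfolding aV using nn by (subst degree_add_eq_right) (auto simp: degree_ev1 dU d\<psi>)
  \<comment> \<open>The strict inequality excludes the base pair and forces \<beta> = 0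
    below.\<close>
  then have dV: "degree V > degree U" using nz nn by (simp add: degree_const2_mult dU)
  from good show ?thesis
  proof (cases rule: good.cases)
    case base
    then show ?thesis using degree_aff_base[OF base] dV by simp
  next
    case (step H1 H2 p)
    define G where "G = H2 + ev1 const2 H1 p"
    have lt: "degree H1 < degree G" unfolding G_def using degree_step good_degree_pos step by blast
    obtain \<alpha> \<beta> \<gamma> \<delta> c' d' where A: "\<alpha> * \<delta> - \<beta> * \<gamma> dvd 1"
      and U: "U = const2 \<alpha> * H1 + const2 \<beta> * G + const2 c'"
      and V: "V = const2 \<gamma> * H1 + const2 \<delta> * G + const2 d'"
      using step(4) unfolding aff_def G_def by blast
    have \<beta>: "\<beta> = 0"
    proof (rule ccontr)
      assume "\<beta> \<noteq> 0"
      then have "degree U = degree G" unfolding U using degree_comb(1)[OF lt] by blast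
      then show False using dV degree_comb_le[OF lt, of \<gamma> \<delta> d'] V by simp
    qed
    then have "\<alpha> dvd 1" using A by (auto dest: dvd_mult_left)
    then obtain \<alpha>' where \<alpha>': "\<alpha>' * \<alpha> = 1" by (metis dvdE mult.commute)
    then have "\<alpha> \<noteq> 0" by auto
    have U': "U = const2 \<alpha> * H1 + const2 c'" using U \<beta> by (simp add: const2_simps)
    then have dH1: "degree H1 = n" using dU \<open>\<alpha> \<noteq> 0\<close> by (simp add: degree_add_const2 degree_const2_mult)
    have "const2 \<alpha>' * U = const2 (\<alpha>' * \<alpha>) * H1 + const2 (\<alpha>' * c')"
      unfolding U' by (simp add: const2_simps algebra_simps)
    then have H1: "H1 = const2 \<alpha>' * U + const2 (- (\<alpha>' * c'))" by (simp add: \<alpha>' const2_simps)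
    \<comment> \<open>As \<alpha> is a unit, \<open>p\<close> can be rewritten in terms of
      \<open>U\<close> without denominators.\<close>
    define p' where "p' = pcompose p [:- (\<alpha>' * c'), \<alpha>':]"
    have p': "ev1 const2 H1 p = ev1 const2 U p'"
      unfolding p'_def by (subst H1) (rule ev1_ev1_affine)
    \<comment> \<open>r(U) will have degree at most deg U, so \<open>r\<close> has degree at most 1
      and the higher coefficients agree.\<close>
    define r where "r = B - smult (a * \<delta>) p'"
    have "ev1 const2 U r = (const2 a * V - \<psi>) - const2 (a * \<delta>) * ev1 const2 H1 p"
      unfolding r_def aV p' by (simp add: rhom_simps[OF rhom_ev1[OF rhom_const2]] ev1_smult rhom_const2)
    also have "\<dots> = const2 a * (const2 \<gamma> * H1 + const2 \<delta> * H2 + const2 d') - \<psi>"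
      unfolding V G_def by (simp add: const2_simps algebra_simps)
    also have "degree \<dots> \<le> n"
    proof (rule degree_diff_le)
      show "degree (const2 a * (const2 \<gamma> * H1 + const2 \<delta> * H2 + const2 d')) \<le> n"
        by (rule order.trans[OF degree_const2_mult_le], subst degree_add_const2, rule degree_add_le;
            rule order.trans[OF degree_const2_mult_le]) (use step dH1 in auto)
      show "degree \<psi> \<le> n" using d\<psi> nB by simp
    qed
    finally have "degree r * n \<le> n" by (simp add: degree_ev1 dU)
    then have "degree r \<le> 1" using nB B by simp
    then have "coeff r i = 0" using i by (intro coeff_eq_0) simp
    then have "coeff B i = a * (\<delta> * coeff p' i)" by (simp add: r_def algebra_simps)
    then show ?thesis by simp
  qed
qed

text \<open>Conjugation by the shear x2 -> x2 - B'(x1) removes the part of \<open>B\<close>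
  divisible by \<open>a\<close>, keeping \<open>c\<close>, \<open>h\<close> and tameness.\<close>

lemma triangular_shift:
  fixes a :: "'a::idom"
  assumes F: "end2 F" "F X1 = X1 + const2 a * f"
      "const2 a * F X2 = const2 a * X2 + ev1 const2 (X1 + const2 a * f) B - ev1 const2 X1 B"
    and f: "const2 c * f = ev1 const2 (const2 a * X2 - ev1 const2 X1 B) h"
    and a: "a \<noteq> 0" and B: "B = [:0, b:] + smult a B'"
  shows "\<exists>F' f'. end2 F' \<and> F' X1 = X1 + const2 a * f' \<and> F' X2 = X2 + const2 b * f'
    \<and> const2 c * f' = ev1 const2 (const2 a * X2 - const2 b * X1) h \<and> (F' \<in> tame2 \<longleftrightarrow> F \<in> tame2)"
proof -
  define T where "T = (\<lambda>p. eval2 p X1 (X2 + ev1 const2 X1 (- B')))"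
  have T: "elementary_aut T" "end2 T" "T X1 = X1" "T X2 = X2 - ev1 const2 X1 B'"
    unfolding T_def by (rule elementary_shear)
      (simp_all add: end2_eval2 eval2_gen rhom_simps[OF rhom_ev1[OF rhom_const2]])
  have TA: "T \<in> Aut2" using T by (simp add: elementary_aut_def)
  then have iT: "end2 (inv T)" using Aut2_inv by (auto simp: Aut2_iff)
  have evB: "ev1 const2 u B = const2 b * u + const2 a * ev1 const2 u B'" for u
    unfolding B by (simp add: ev1_add ev1_pCons ev1_smult rhom_const2 mult.commute)
  have "const2 a * F X2 = const2 a * (X2 + const2 b * f + ev1 const2 (X1 + const2 a * f) B' - ev1 const2 X1 B')"
    unfolding F(3) evB by (simp add: algebra_simps)
  then have FX2: "F X2 = X2 + const2 b * f + ev1 const2 (X1 + const2 a * f) B' - ev1 const2 X1 B'"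
    using a by (simp)
  define F' where "F' = inv T \<circ> F \<circ> T"
  define f' where "f' = inv T f"
  have F': "end2 F'" unfolding F'_def by (intro end2_comp iT F T)
  have iX1: "inv T X1 = X1" using Aut2_inv_apply(2)[OF TA, of X1] T by simp
  have iX2: "inv T (X2 - ev1 const2 X1 B') = X2" using Aut2_inv_apply(2)[OF TA, of X2] T by simp
  then have iX2': "inv T X2 = X2 + ev1 const2 X1 B'"
    by (simp add: end2_simps[OF iT] end2_ev1[OF iT] iX1 diff_eq_eq)
  have 1: "F' X1 = X1 + const2 a * f'"
    by (simp add: F'_def T F end2_simps[OF iT] iX1 f'_def)
  have "F (T X2) = (X2 - ev1 const2 X1 B') + const2 b * f"
    by (simp add: T end2_simps[OF F(1)] end2_ev1[OF F(1)] FX2 F(2))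
  then have 2: "F' X2 = X2 + const2 b * f'"
    unfolding F'_def comp_apply by (simp only: rhom_add[OF end2_rhom[OF iT]] rhom_mult[OF end2_rhom[OF iT]] iX2 end2_const2[OF iT] f'_def)
  have "const2 c * f' = inv T (const2 c * f)" by (simp add: end2_simps[OF iT] f'_def)
  also have "const2 c * f = ev1 const2 (const2 a * (X2 - ev1 const2 X1 B') - const2 b * X1) h"
    unfolding f evB by (simp add: algebra_simps)
  also have "inv T \<dots> = ev1 const2 (const2 a * X2 - const2 b * X1) h"
    by (simp add: end2_simps[OF iT] end2_ev1[OF iT] iX1 iX2')
  finally have 3: "const2 c * f' = ev1 const2 (const2 a * X2 - const2 b * X1) h" .
  have Tt: "T \<in> tame2" "inv T \<in> tame2" using T(1) tame2.gen tame2.inverse by auto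
  have "F = T \<circ> F' \<circ> inv T" unfolding F'_def by (rule ext) (simp add: Aut2_inv_apply[OF TA])
  then have "F' \<in> tame2 \<longleftrightarrow> F \<in> tame2"
    unfolding F'_def using Tt tame2.comp by metis
  then show ?thesis using F' 1 2 3 by blast
qed

section \<open>The exponential as a time-one flow\<close>

lemma ratinv_eq:
  assumes "c * of_nat n = (1 :: 'a::idom)"
  shows "ratinv n = c"
proof -
  have "of_nat n \<noteq> (0::'a)" using assms by auto
  then show ?thesis unfolding ratinv_def
    using assms by (intro the_equality) (auto, metis mult_right_cancel)
qed

text \<open>exp tE is characterised as the homomorphism into R[x1,x2][t] that solves the
  differential equation d/dt = E with initial value the identity.\<close>

lemma exp_der_flow:
  fixes E :: "'a::idom poly poly \<Rightarrow> 'a poly poly" and \<psi> :: "'a poly poly \<Rightarrow> 'a poly poly poly"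
  assumes Q: "\<forall>n::nat. n \<noteq> 0 \<longrightarrow> (\<exists>c::'a. c * of_nat n = 1)"
    and init: "\<And>p. coeff (\<psi> p) 0 = p" and flow: "\<And>p. pderiv (\<psi> p) = \<psi> (E p)"
  shows "exp_der E p = poly (\<psi> p) 1"
proof -
  have ch: "char0 TYPE('a)" unfolding char0_def using Q by (metis mult_zero_right zero_neq_one)
  \<comment> \<open>The Taylor coefficients at t = 0, from the differential equation.\<close>
  have c: "of_nat (fact k) * coeff (\<psi> p) k = (E ^^ k) p" for k p
  proof (induction k arbitrary: p)
    case (Suc k)
    have "of_nat (fact (Suc k)) * coeff (\<psi> p) (Suc k) = of_nat (fact k) * (of_nat (Suc k) * coeff (\<psi> p) (Suc k))"
      by (simp add: algebra_simps)
    also have "of_nat (Suc k) * coeff (\<psi> p) (Suc k) = coeff (\<psi> (E p)) k"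
      by (simp only: coeff_pderiv[symmetric] flow)
    also have "of_nat (fact k) * \<dots> = (E ^^ Suc k) p"
      by (simp add: Suc funpow_swap1)
    finally show ?case .
  qed (simp add: init)
  have r: "ratinv (fact k) * of_nat (fact k) = (1::'a)" for k
    using Q ratinv_eq fact_nonzero by metis
  have on: "of_nat n = const2 (of_nat n)" for n
    by (simp add: const2_def of_nat_poly)
  have s: "const2 (ratinv (fact k)) * (E ^^ k) p = coeff (\<psi> p) k" for k
  proof -
    have "const2 (ratinv (fact k)) * (E ^^ k) p = const2 (ratinv (fact k) * of_nat (fact k)) * coeff (\<psi> p) k"
      by (simp only: c[symmetric] on const2_simps mult.assoc)
    then show ?thesis by (simp add: r const2_simps)
  qed
  have "of_nat (fact k) \<noteq> (0 :: 'a poly poly)" for k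
    using char0D[OF char0_poly[OF char0_poly[OF ch]]] fact_nonzero by blast
  \<comment> \<open>k! is nonzero in a domain, so the defining sum runs over the nonzero Taylor
    coefficients.\<close>
  then have set: "{k. (E ^^ k) p \<noteq> 0} = {k. coeff (\<psi> p) k \<noteq> 0}"
    unfolding c[symmetric] by simp
  have "exp_der E p = (\<Sum>k | coeff (\<psi> p) k \<noteq> 0. coeff (\<psi> p) k)"
    by (simp add: exp_der_def s set)
  also have "\<dots> = (\<Sum>k\<le>degree (\<psi> p). coeff (\<psi> p) k)"
    by (rule sum.mono_neutral_left) (auto simp: le_degree)
  also have "\<dots> = poly (\<psi> p) 1" by (simp add: poly_altdef)
  finally show ?thesis .
qed

lemma pderiv_ev1:
  assumes "rhom i" "\<And>c. pderiv (i c) = 0"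
  shows "pderiv (ev1 i U q) = ev1 i U (pderiv q) * pderiv U"
  by (induction q) (simp_all add: ev1_pCons assms pderiv_pCons pderiv_add pderiv_mult ev1_add rhom_0[OF assms(1)] algebra_simps)

text \<open>The flow is explicit: x1 goes to U = x1 + t a f, and x2 to \<open>V\<close> with a V = a
  x2 + B(U) - B(x1). Along it g = a x2 - B(x1) is constant, hence so is \<open>f\<close>.\<close>

lemma exp_triangular:
  fixes a :: "'a::idom"
  assumes Q: "\<forall>n::nat. n \<noteq> 0 \<longrightarrow> (\<exists>c::'a. c * of_nat n = 1)" and a: "a \<noteq> 0"
    and B: "pderiv B = q" and f: "const2 c * f = ev1 const2 (const2 a * X2 - ev1 const2 X1 B) h" and c: "c \<noteq> 0"
  defines "F \<equiv> exp_der (\<lambda>p. f * der2 (const2 a) [:q:] p)"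
  shows "end2 F" "F X1 = X1 + const2 a * f"
      "const2 a * F X2 = const2 a * X2 + ev1 const2 (X1 + const2 a * f) B - ev1 const2 X1 B"
proof -
  define i :: "'a \<Rightarrow> 'a poly poly poly" where "i r = [:const2 r:]" for r
  have i: "rhom i" unfolding i_def by (rule rhom_comp[OF rhom_const2 rhom_const])
  have di: "pderiv (i r) = 0" for r by (simp add: i_def)
  have ce: "ev1 i [:u:] p = [:ev1 const2 u p:]" for u p
    using rhom_ev1_commute[OF rhom_const2 rhom_const, of u p] by (simp add: i_def[abs_def])
  define U where "U = [:X1, const2 a * f:]"
  \<comment> \<open>B(U) - B(x1) is divisible by t a f, so \<open>V\<close> exists without
    denominators.\<close>
  have "U - [:X1:] dvd ev1 i U B - ev1 i [:X1:] B" by (rule ev1_diff_dvd[OF i])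
  moreover have "U - [:X1:] = i a * [:0, f:]" by (simp add: U_def i_def)
  ultimately obtain W where W: "ev1 i U B - [:ev1 const2 X1 B:] = i a * ([:0, f:] * W)"
    unfolding ce by (metis dvdE mult.assoc)
  define V where "V = [:X2:] + [:0, f:] * W"
  have V: "i a * V = i a * [:X2:] + ev1 i U B - [:ev1 const2 X1 B:]"
    using W by (simp add: V_def algebra_simps)
  have ia: "i a \<noteq> 0" "i c \<noteq> 0" using a c by (simp_all add: i_def)
  define \<psi> where "\<psi> = ev2 i U V"
  have \<psi>: "rhom \<psi>" "\<psi> (const2 r) = i r" "\<psi> X1 = U" "\<psi> X2 = V" for r
    unfolding \<psi>_def by (simp_all add: rhom_ev2 ev2_const2 ev2_X1 ev2_X2 i)
  note \<psi>s = \<psi>(2-4) rhom_simps[OF \<psi>(1)]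
  have \<psi>1: "\<psi> (ev1 const2 u p) = ev1 i (\<psi> u) p" for u p
    by (simp add: rhom_ev1_commute[OF rhom_const2 \<psi>(1)] \<psi>(2))
  \<comment> \<open>Cancels the two B(U) terms, which shows that g is invariant.\<close>
  have "x + y - z - y = x - z" for x y z :: "'a poly poly poly" by simp
  then have \<psi>g: "\<psi> (const2 a * X2 - ev1 const2 X1 B) = i a * [:X2:] - [:ev1 const2 X1 B:]"
    unfolding rhom_diff[OF \<psi>(1)] rhom_mult[OF \<psi>(1)] \<psi>1 \<psi>(2-4) V .
  have "i c * \<psi> f = \<psi> (const2 c * f)" by (simp add: \<psi>s)
  also have "\<dots> = ev1 i (i a * [:X2:] - [:ev1 const2 X1 B:]) h"
    unfolding f \<psi>1 \<psi>g ..
  also have "i a * [:X2:] - [:ev1 const2 X1 B:] = [:const2 a * X2 - ev1 const2 X1 B:]"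
    by (simp add: i_def)
  also have "ev1 i \<dots> h = i c * [:f:]" unfolding ce f[symmetric] by (simp add: i_def)
  finally have \<psi>f: "\<psi> f = [:f:]" by (rule mult_left_cancel[OF ia(2), THEN iffD1])
  have init: "coeff (\<psi> p) 0 = p" for p
    by (induction p rule: poly2_induct)
      (simp_all add: \<psi>s coeff_mult_0 i_def U_def V_def)
  define E where "E = (\<lambda>p. f * der2 (const2 a) [:q:] p)"
  have "i a * pderiv V = pderiv (i a * V)" by (simp add: pderiv_mult di)
  also have "\<dots> = i a * (ev1 i U q * [:f:])"
    unfolding V by (simp add: pderiv_mult pderiv_add pderiv_diff di pderiv_ev1[OF i di] B)
      (simp add: U_def i_def pderiv_pCons mult.commute)
  finally have dV: "pderiv V = ev1 i U q * [:f:]" by (rule mult_left_cancel[OF ia(1), THEN iffD1])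
  have q: "[:q:] = ev1 const2 X1 q" by (simp add: ev1_X1)
  \<comment> \<open>Both sides obey the same product rule, so the generators decide.\<close>
  have flow: "pderiv (\<psi> p) = \<psi> (E p)" for p
  proof (induction p rule: poly2_induct)
    case (const r)
    show ?case by (simp add: \<psi>s di E_def)
  next
    case X1
    show ?case by (simp add: \<psi>s E_def \<psi>f) (simp add: U_def i_def pderiv_pCons mult.commute)
  next
    case X2
    show ?case by (simp add: \<psi>s E_def \<psi>f q \<psi>1 dV)
  next
    case (add p p')
    then show ?case by (simp add: \<psi>s E_def pderiv_add der2_add algebra_simps)
  next
    case (mult p p')
    then show ?case by (simp add: \<psi>s E_def pderiv_mult der2_mult algebra_simps)
  qed
  have F: "F = (\<lambda>p. poly (\<psi> p) 1)"
    unfolding F_def E_def[symmetric] using exp_der_flow[OF Q init flow] by blast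
  show "end2 F" unfolding end2_def F
    by (auto simp: \<psi>s i_def intro: rhom_comp[OF \<psi>(1) rhom_poly])
  show "F X1 = X1 + const2 a * f" by (simp add: F \<psi>s U_def)
  have "const2 a * F X2 = poly (i a * V) 1" by (simp add: F \<psi>s i_def)
  also have "\<dots> = const2 a * X2 + poly (ev1 i U B) 1 - ev1 const2 X1 B"
    unfolding V by (simp add: i_def)
  also have "poly (ev1 i U B) 1 = ev1 const2 (X1 + const2 a * f) B"
    unfolding rhom_ev1_commute[OF i rhom_poly] by (simp add: i_def[abs_def] U_def)
  finally show "const2 a * F X2 = const2 a * X2 + ev1 const2 (X1 + const2 a * f) B - ev1 const2 X1 B" .
qed

section \<open>Assembly of the criterion\<close>

text \<open>The factor \<open>Suc i\<close> between the two coefficients is a unit of R.\<close>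

lemma dvd_coeff_pderiv_iff:
  fixes a :: "'a::idom"
  assumes Q: "\<forall>n::nat. n \<noteq> 0 \<longrightarrow> (\<exists>c::'a. c * of_nat n = 1)"
  shows "a dvd coeff (pderiv B) i \<longleftrightarrow> a dvd coeff B (Suc i)"
proof -
  obtain c :: 'a where "c * of_nat (Suc i) = 1" using Q by blast
  then have "coeff B (Suc i) = c * coeff (pderiv B) i" by (simp add: coeff_pderiv flip: mult.assoc)
  then show ?thesis by (metis coeff_pderiv dvd_mult)
qed

text \<open>A denominator-free form of membership; nonzero \<open>b\<close> is what makes \<alpha>
  nonzero.\<close>

lemma Vset_iff:
  fixes a b :: "'a::idom"
  assumes "a \<noteq> 0" "b \<noteq> 0"
  shows "Fract b a \<in> Vset \<longleftrightarrow> (\<exists>\<alpha> \<beta> s t. \<beta> \<noteq> 0 \<and> s * \<alpha> + t * \<beta> = 1 \<and> b * \<beta> = a * \<alpha>)"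
proof
  assume "Fract b a \<in> Vset"
  then obtain \<alpha> \<beta> s t where "Fract b a = Fract \<alpha> \<beta>" "\<beta> \<noteq> 0" "s * \<alpha> + t * \<beta> = 1"
    unfolding Vset_def by blast
  then show "\<exists>\<alpha> \<beta> s t. \<beta> \<noteq> 0 \<and> s * \<alpha> + t * \<beta> = 1 \<and> b * \<beta> = a * \<alpha>"
    using assms by (metis eq_fract(1) mult.commute)
next
  assume "\<exists>\<alpha> \<beta> s t. \<beta> \<noteq> 0 \<and> s * \<alpha> + t * \<beta> = 1 \<and> b * \<beta> = a * \<alpha>"
  then obtain \<alpha> \<beta> s t where *: "\<beta> \<noteq> 0" "s * \<alpha> + t * \<beta> = 1" "b * \<beta> = a * \<alpha>" by blast
  then have "\<alpha> \<noteq> 0" using assms by auto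
  moreover have "Fract b a = Fract \<alpha> \<beta>" using * assms by (simp add: eq_fract mult.commute)
  ultimately show "Fract b a \<in> Vset" unfolding Vset_def using * by blast
qed

text \<open>Index 0 is treated uniformly: if \<open>a\<close> divides \<open>coeff q 0\<close>, a
  unimodular pair exists trivially.\<close>

lemma exp_triangular_tame_iff:
  fixes a :: "'a::idom" and q :: "'a poly" and f :: "'a poly poly"
  assumes Q: "\<forall>n::nat. n \<noteq> 0 \<longrightarrow> (\<exists>c::'a. c * of_nat n = 1)"
    and a: "a \<noteq> 0" and ker: "der2 (const2 a) [:q:] f = 0" and nc: "f \<notin> range const2"
  shows "exp_der (\<lambda>p. f * der2 (const2 a) [:q:] p) \<in> tame2 \<longleftrightarrow>
    (\<forall>i\<ge>1. a dvd coeff q i) \<and>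
    (degree f = 1 \<or> (\<exists>\<alpha> \<beta> s t. \<beta> \<noteq> 0 \<and> s * \<alpha> + t * \<beta> = 1 \<and> coeff q 0 * \<beta> = a * \<alpha>))"
    (is "?F \<in> _ \<longleftrightarrow> ?A \<and> ?C")
proof -
  have ch: "char0 TYPE('a)" unfolding char0_def using Q by (metis mult_zero_right zero_neq_one)
  obtain B where B: "pderiv B = q" "coeff B 0 = 0" using pderiv_surj[OF Q] by blast
  obtain c h where c: "c \<noteq> 0" and h: "const2 c * f = ev1 const2 (const2 a * X2 - ev1 const2 X1 B) h"
    using der2_kernel[OF ch a B(1) ker] by blast
  note F = exp_triangular[OF Q a B(1) h c]
  have g: "const2 a * X2 - ev1 const2 X1 B = [:- B, [:a:]:]" by (simp add: ev1_X1 const2_def X2_def)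
  have "degree (const2 c * f) = degree h" unfolding h g using a by (simp add: degree_ev1)
  then have dh: "degree h = degree f" using c by (simp add: degree_const2_mult)
  \<comment> \<open>A constant \<open>h\<close> would put c f, and hence \<open>f\<close>, into
    R.\<close>
  have "degree h \<noteq> 0"
  proof
    assume "degree h = 0"
    then obtain r where "h = [:r:]" by (metis degree_0_id)
    then have r: "smult [:c:] f = [:[:r:]:]" using h by (simp add: ev1_const rhom_const2) (simp add: const2_def)
    then have "degree f = 0" using c by (metis degree_pCons_0 degree_smult_eq pCons_eq_0_iff)
    then obtain p where p: "f = [:p:]" by (metis degree_0_id)
    then have "smult c p = [:r:]" using r by simp
    then have "degree p = 0" using c by (metis degree_pCons_0 degree_smult_eq)
    then obtain x where "p = [:x:]" by (metis degree_0_id)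
    then show False using nc p by (auto simp: const2_def)
  qed
  then have h1: "degree h \<ge> 1" by simp
  show ?thesis
  proof (cases ?A)
    case False
    then obtain i where i: "i \<ge> 1" "\<not> a dvd coeff q i" by blast
    \<comment> \<open>Integration shifts the index by one, so indices from 1 on for \<open>q\<close>
      become indices from 2 on for \<open>B\<close>.\<close>
    then have ni: "\<not> a dvd coeff B (Suc i)" using dvd_coeff_pderiv_iff[OF Q, of a B i] B by simp
    then have "coeff B (Suc i) \<noteq> 0" by auto
    then have "degree B \<ge> 2" using le_degree[of B "Suc i"] i by simp
    then have "?F \<notin> tame2" using triangular_tame_dvd[OF ch F h c a h1, of "Suc i"] ni i by auto
    then show ?thesis using False by blast
  next
    case True
    define b where "b = coeff q 0"
    have B1: "coeff B (Suc 0) = b" unfolding b_def B(1)[symmetric] by (simp add: coeff_pderiv)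
    \<comment> \<open>Index 0 uses the integration constant 0, index 1 is \<open>b\<close> itself,
      and the others come from divisibility in \<open>q\<close>.\<close>
    have "[:a:] dvd B - [:0, b:]"
      unfolding const_poly_dvd_iff
    proof
      fix n
      consider "n = 0" | "n = Suc 0" | i where "n = Suc (Suc i)" by (metis not0_implies_Suc)
      then show "a dvd coeff (B - [:0, b:]) n"
      proof cases
        case 3
        then show ?thesis using True dvd_coeff_pderiv_iff[OF Q, of a B "Suc i"] B by simp
      qed (simp_all add: B(2) B1)
    qed
    then obtain B' where "B - [:0, b:] = smult a B'" by (auto elim: dvdE)
    then have "B = [:0, b:] + smult a B'" by (simp add: algebra_simps)
    from triangular_shift[OF F h a this] obtain F' f' where
      *: "end2 F'" "F' X1 = X1 + const2 a * f'" "F' X2 = X2 + const2 b * f'"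
        "const2 c * f' = ev1 const2 (const2 a * X2 - const2 b * X1) h" "F' \<in> tame2 \<longleftrightarrow> ?F \<in> tame2"
      by blast
    show ?thesis using translation_tame_iff[OF ch *(1-4) c a h1] *(5) True unfolding dh b_def by blast
  qed
qed

theorem theorem3p2p2:
  fixes a :: "'a::idom" and b :: "nat \<Rightarrow> 'a" and l :: nat and f :: "'a poly poly"
  assumes Qdom: "\<forall>n::nat. n \<noteq> 0 \<longrightarrow> (\<exists>c::'a. c * of_nat n = 1)"
    and a_nz: "a \<noteq> 0" and bl_nz: "b l \<noteq> 0"
    and f_ker: "der2 (const2 a) [:\<Sum>i\<le>l. monom (b i) i:] f = 0"
    and f_nc: "f \<notin> range const2"
  shows "(exp_der (\<lambda>p. f * der2 (const2 a) [:\<Sum>i\<le>l. monom (b i) i:] p) \<in> tame2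
           \<longleftrightarrow> ({i\<in>{0..l}. \<not> a dvd b i} = {}
                \<or> ({i\<in>{0..l}. \<not> a dvd b i} = {0} \<and> (Fract (b 0) a \<in> Vset \<or> degree f = 1))))
       \<and> ((Vset :: 'a fract set) = {x. x \<noteq> 0} \<longrightarrow>
           (exp_der (\<lambda>p. f * der2 (const2 a) [:\<Sum>i\<le>l. monom (b i) i:] p) \<in> tame2
            \<longleftrightarrow> (\<forall>i\<in>{1..l}. a dvd b i)))"
proof -
  define q where "q = (\<Sum>i\<le>l. monom (b i) i)"
  define C where "C \<longleftrightarrow> (\<exists>\<alpha> \<beta> s t. \<beta> \<noteq> 0 \<and> s * \<alpha> + t * \<beta> = 1 \<and> b 0 * \<beta> = a * \<alpha>)"
  have cq: "coeff q i = (if i \<le> l then b i else 0)" for i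
    by (simp add: q_def coeff_sum)
  have "(\<forall>i\<ge>1. a dvd coeff q i) \<longleftrightarrow> (\<forall>i\<in>{1..l}. a dvd b i)"
    by (auto simp: cq)
  then have tame: "exp_der (\<lambda>p. f * der2 (const2 a) [:q:] p) \<in> tame2 \<longleftrightarrow>
      (\<forall>i\<in>{1..l}. a dvd b i) \<and> (degree f = 1 \<or> C)"
    using exp_triangular_tame_iff[OF Qdom a_nz f_ker f_nc] unfolding q_def[symmetric] C_def
    by (simp add: cq)
  \<comment> \<open>The pair (k, 1) with b_0 = a k is unimodular, so the extra condition is
    automatic here.\<close>
  have C1: C if "a dvd b 0"
  proof -
    from that obtain k where "b 0 = a * k" by (elim dvdE)
    then show ?thesis unfolding C_def by (intro exI[of _ k] exI[of _ 1] exI[of _ 0]) simp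
  qed
  have C2: "Fract (b 0) a \<in> Vset \<longleftrightarrow> C" if "\<not> a dvd b 0"
    using Vset_iff[OF a_nz, of "b 0"] that unfolding C_def by fastforce
  have l: "{0..l} = insert 0 {1..l}" "0 \<notin> {1..l}" by auto
  have I0: "{i\<in>{0..l}. \<not> a dvd b i} = {} \<longleftrightarrow> (\<forall>i\<in>{1..l}. a dvd b i) \<and> a dvd b 0"
    unfolding l(1) by (metis (no_types, lifting) empty_Collect_eq insert_iff)
  have I1: "{i\<in>{0..l}. \<not> a dvd b i} = {0} \<longleftrightarrow> (\<forall>i\<in>{1..l}. a dvd b i) \<and> \<not> a dvd b 0"
    unfolding l(1)
  proof (intro iffI conjI ballI notI)
    fix i assume "{i \<in> insert 0 {1..l}. \<not> a dvd b i} = {0}" and i: "i \<in> {1..l}"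
    then have "\<not> a dvd b i \<Longrightarrow> i \<in> {0}" by blast
    then show "a dvd b i" using i l(2) by blast
  qed blast+
  \<comment> \<open>If every nonzero fraction lies in \<open>Vset\<close>, the condition on b_0
    always holds.\<close>
  have V: "C" if "(Vset :: 'a fract set) = {x. x \<noteq> 0}"
  proof (cases "a dvd b 0")
    case False
    then have "b 0 \<noteq> 0" by auto
    then have "Fract (b 0) a \<noteq> 0" using a_nz by (simp add: Zero_fract_def eq_fract)
    then show ?thesis using that C2[OF False] by blast
  qed (rule C1)
  show ?thesis unfolding q_def[symmetric] tame I0 I1 using C1 C2 V by blast
qed

end
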